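(* Let $M$ be a 4-dimensional manifold and let $F$ be any $(\alpha,\beta)$-metric, constructed from a pseudo-Riemannian metric $a_{\mu\nu}$ and a 1-form $b$ on $M$, such that: (i) $a_{\mu\nu}$ solves the classical Einstein equations in vacuum (its Ricci tensor vanishes); (ii) $b$ is covariantly constant with respect to the Levi-Civita connection of $a_{\mu\nu}$. Then $F$ is a Ricci-flat vacuum solution to the field equation in Finsler gravity. Moreover, the affine connection of $F$ coincides with the Levi-Civita connection of $a_{\mu\nu}$ (in particular $F$ is of Berwald type).
   Context: Coordinates $x^\mu$ on $M$ induce coordinates $(x^\mu,y^\mu)$ on $TM$; $\partial_\mu=\partial/\partial x^\mu$, $\bar\partial_\mu=\partial/\partial y^\mu$. A conic subbundle $\mathcal A\subset TM$ is an open subset projecting onto $M$ and closed under $(x,y)\mapsto(x,\lambda y)$, $\lambda>0$. A Finsler metric on $\mathcal A$ is a smooth $F:\mathcal A\to\mathbb R$ with $F(x,\lambda y)=\lambda F(x,y)$ for $\lambda>0$ and $g_{\mu\nu}=\tfrac12\bar\partial_\mu\bar\partial_\nu F^2$ nondegenerate; $L=F^2$. Canonical nonlinear connection: $N^\rho_\mu=\tfrac14\bar\partial_\mu[g^{\rho\sigma}(y^\lambda\partial_\lambda\bar\partial_\sigma L-\partial_\sigma L)]$; $\delta_\mu=\partial_\mu-N^\rho_\mu\bar\partial_\rho$; $G^\rho=N^\rho_\mu y^\mu$. $F$ is of Berwald type if $N^\rho_\mu=\Gamma^\rho_{\mu\nu}(x)y^\nu$, and then $\Gamma^\rho_{\mu\nu}$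 are the Christoffel symbols of the affine connection of $F$. Curvatures: $R^\rho_{\mu\nu}=\delta_\mu N^\rho_\nu-\delta_\nu N^\rho_\mu$, $\mathrm{Ric}=R^\mu_{\mu\nu}y^\nu$, $R_{\mu\nu}=\tfrac12\bar\partial_\mu\bar\partial_\nu\mathrm{Ric}$; $F$ is Ricci-flat if $R_{\mu\nu}=0$. The (Pfeifer-Wohlfarth) vacuum field equation in Finsler gravity (dimension 4) is, on $\mathcal A$, $$-2\,\mathrm{Ric}+\tfrac{2L}{3}g^{\mu\nu}R_{\mu\nu}+\tfrac{2L}{3}g^{\mu\nu}\big(\bar\partial_\mu(D S_\nu)-S_\mu S_\nu+\nabla^C_{\delta_\mu}S_\nu\big)=0,$$ where $S_\mu=g^{\nu\rho}S_{\mu\nu\rho}$, $S_{\mu\nu\rho}=-\tfrac14y_\sigma\bar\partial_\mu\bar\partial_\nu\bar\partial_\rho G^\sigma$ with $y_\sigma=g_{\sigma\lambda}y^\lambda$, $DS_\nu=y^\rho\delta_\rho S_\nu-N^\rho_\nu S_\rho$ (dynamical covariant derivative), and $\nabla^C_{\delta_\mu}S_\nu=\delta_\mu S_\nu-{}^C\Gamma^\rho_{\mu\nu}S_\rho$ with ${}^C\Gamma^\rho_{\mu\nu}=\tfrac12g^{\rho\sigma}(\delta_\mu g_{\sigma\nu}+\delta_\nu g_{\mu\sigma}-\delta_\sigma g_{\mu\nu})$. For Berwald metrics $S_\mu=0$ and it reduces to $(Lg^{\mu\nu}-3y^\mu y^\nu)R_{\mu\nu}=0$. An $(\alpha,\beta)$-metric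 is a Finsler metric $F=\alpha\phi(\beta/\alpha)$, on a conic subbundle where $\alpha\ne0$, with $\phi$ a smooth function of one real variable, $\alpha=\sqrt{|a_{\mu\nu}y^\mu y^\nu|}$, $\beta=b_\mu y^\mu$. *)

theory Defs
  imports "HOL-Analysis.Analysis"
begin

section \<open>Smooth functions\<close>

primrec times_differentiable_on ::
    "nat \<Rightarrow> 'a::real_normed_vector set \<Rightarrow> ('a \<Rightarrow> 'b::real_normed_vector) \<Rightarrow> bool" where
  "times_differentiable_on 0 S f \<longleftrightarrow> continuous_on S f"
| "times_differentiable_on (Suc k) S f \<longleftrightarrow>
     (\<forall>x\<in>S. f differentiable (at x)) \<and>
     (\<forall>v. times_differentiable_on k S (\<lambda>x. frechet_derivative f (at x) v))"

text \<open>Only meaningful for open \<open>S\<close>, as derivatives are taken in the ambient space.\<close>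

definition smooth_on :: "'a::real_normed_vector set \<Rightarrow> ('a \<Rightarrow> 'b::real_normed_vector) \<Rightarrow> bool" where
  "smooth_on S f \<longleftrightarrow> (\<forall>k. times_differentiable_on k S f)"


section \<open>Smooth manifolds and their tangent bundles\<close>

text \<open>A chart is a pair of its domain and its coordinate map; the latter is arbitrary outside
  the domain. The dimension of the manifold is \<open>CARD('n)\<close>.\<close>

type_synonym ('m, 'n) chart = "'m set \<times> ('m \<Rightarrow> real ^ 'n)"

definition chart_range :: "('m, 'n) chart \<Rightarrow> (real ^ 'n) set" where
  "chart_range c = snd c ` fst c"

definition chart_inv :: "('m, 'n) chart \<Rightarrow> real ^ 'n \<Rightarrow> 'm" where
  "chart_inv c = inv_into (fst c) (snd c)"

definition transition :: "('m, 'n) chart \<Rightarrow> ('m, 'n) chart \<Rightarrow> real ^ 'n \<Rightarrow> real ^ 'n" where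
  "transition c c' = snd c' \<circ> chart_inv c"

definition smooth_manifold :: "'m topology \<Rightarrow> ('m, 'n::finite) chart set \<Rightarrow> bool" where
  "smooth_manifold M \<A> \<longleftrightarrow>
     Hausdorff_space M \<and>
     second_countable M \<and>
     (\<forall>c\<in>\<A>. openin M (fst c) \<and> open (chart_range c) \<and>
        homeomorphic_map (subtopology M (fst c)) (top_of_set (chart_range c)) (snd c)) \<and>
     (\<Union>c\<in>\<A>. fst c) = topspace M \<and>
     (\<forall>c\<in>\<A>. \<forall>c'\<in>\<A>. smooth_on (snd c ` (fst c \<inter> fst c')) (transition c c'))"

text \<open>A tangent vector at \<open>p\<close> is the family of its components in all charts around \<open>p\<close>, related by
  the Jacobians of the transition maps; it is set to zero at charts not containing \<open>p\<close>.\<close>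

type_synonym ('m, 'n) tvector = "('m, 'n) chart \<Rightarrow> real ^ 'n"

definition tangent_space :: "('m, 'n::finite) chart set \<Rightarrow> 'm \<Rightarrow> ('m, 'n) tvector set" where
  "tangent_space \<A> p = {v.
     (\<forall>c\<in>\<A>. \<forall>c'\<in>\<A>. p \<in> fst c \<and> p \<in> fst c' \<longrightarrow>
        v c' = frechet_derivative (transition c c') (at (snd c p)) (v c)) \<and>
     (\<forall>c. c \<notin> \<A> \<or> p \<notin> fst c \<longrightarrow> v c = 0)}"

definition tv_zero :: "('m, 'n::finite) tvector" where
  "tv_zero = (\<lambda>c. 0)"

definition tv_add :: "('m, 'n::finite) tvector \<Rightarrow> ('m, 'n) tvector \<Rightarrow> ('m, 'n) tvector" where
  "tv_add v w = (\<lambda>c. v c + w c)"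

definition tv_scale :: "real \<Rightarrow> ('m, 'n::finite) tvector \<Rightarrow> ('m, 'n) tvector" where
  "tv_scale r v = (\<lambda>c. r *\<^sub>R v c)"

text \<open>The tangent vector \<open>\<Sum>\<^sub>\<mu> y\<^sup>\<mu> \<partial>\<^sub>\<mu>\<close> at \<open>p\<close>, for the coordinates of the chart \<open>c\<close>.\<close>

definition tvector_of ::
    "('m, 'n::finite) chart set \<Rightarrow> ('m, 'n) chart \<Rightarrow> 'm \<Rightarrow> real ^ 'n \<Rightarrow> ('m, 'n) tvector" where
  "tvector_of \<A> c p y = (\<lambda>c'. if c' \<in> \<A> \<and> p \<in> fst c'
     then frechet_derivative (transition c c') (at (snd c p)) y else 0)"

type_synonym ('m, 'n) tpoint = "'m \<times> ('m, 'n) tvector"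

definition tangent_bundle :: "'m topology \<Rightarrow> ('m, 'n::finite) chart set \<Rightarrow> ('m, 'n) tpoint set" where
  "tangent_bundle M \<A> = Sigma (topspace M) (tangent_space \<A>)"

text \<open>The inverse of the induced chart \<open>(x, y)\<close> of the tangent bundle; subsets of and functions on
  the tangent bundle expressed in the induced coordinates.\<close>

type_synonym 'n coords = "(real ^ 'n) \<times> (real ^ 'n)"

definition bundle_point ::
    "('m, 'n::finite) chart set \<Rightarrow> ('m, 'n) chart \<Rightarrow> 'n coords \<Rightarrow> ('m, 'n) tpoint" where
  "bundle_point \<A> c z = (chart_inv c (fst z), tvector_of \<A> c (chart_inv c (fst z)) (snd z))"

definition local_set ::
    "('m, 'n::finite) chart set \<Rightarrow> ('m, 'n) chart \<Rightarrow> ('m, 'n) tpoint set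
       \<Rightarrow> 'n coords set" where
  "local_set \<A> c A = {z. fst z \<in> chart_range c \<and> bundle_point \<A> c z \<in> A}"

definition local_fun ::
    "('m, 'n::finite) chart set \<Rightarrow> ('m, 'n) chart \<Rightarrow> (('m, 'n) tpoint \<Rightarrow> real)
       \<Rightarrow> 'n coords \<Rightarrow> real" where
  "local_fun \<A> c F = (\<lambda>z. F (bundle_point \<A> c z))"


section \<open>Pseudo-Riemannian metrics and 1-forms\<close>

type_synonym ('m, 'n) covector_field = "'m \<Rightarrow> ('m, 'n) tvector \<Rightarrow> real"
type_synonym ('m, 'n) bilinear_field = "'m \<Rightarrow> ('m, 'n) tvector \<Rightarrow> ('m, 'n) tvector \<Rightarrow> real"

definition linear_form_on_tangent ::
    "('m, 'n::finite) chart set \<Rightarrow> 'm \<Rightarrow> (('m, 'n) tvector \<Rightarrow> real) \<Rightarrow> bool" where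
  "linear_form_on_tangent \<A> p f \<longleftrightarrow>
     (\<forall>v\<in>tangent_space \<A> p. \<forall>w\<in>tangent_space \<A> p. f (tv_add v w) = f v + f w) \<and>
     (\<forall>v\<in>tangent_space \<A> p. \<forall>r. f (tv_scale r v) = r * f v)"

definition coord_vector ::
    "('m, 'n::finite) chart set \<Rightarrow> ('m, 'n) chart \<Rightarrow> real ^ 'n \<Rightarrow> 'n \<Rightarrow> ('m, 'n) tvector" where
  "coord_vector \<A> c x \<mu> = tvector_of \<A> c (chart_inv c x) (axis \<mu> 1)"

definition form_comp ::
    "('m, 'n::finite) chart set \<Rightarrow> ('m, 'n) chart \<Rightarrow> ('m, 'n) covector_field
       \<Rightarrow> 'n \<Rightarrow> real ^ 'n \<Rightarrow> real" where
  "form_comp \<A> c b \<mu> = (\<lambda>x. b (chart_inv c x) (coord_vector \<A> c x \<mu>))"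

definition metric_comp ::
    "('m, 'n::finite) chart set \<Rightarrow> ('m, 'n) chart \<Rightarrow> ('m, 'n) bilinear_field
       \<Rightarrow> 'n \<Rightarrow> 'n \<Rightarrow> real ^ 'n \<Rightarrow> real" where
  "metric_comp \<A> c a \<mu> \<nu> =
     (\<lambda>x. a (chart_inv c x) (coord_vector \<A> c x \<mu>) (coord_vector \<A> c x \<nu>))"

definition one_form ::
    "'m topology \<Rightarrow> ('m, 'n::finite) chart set \<Rightarrow> ('m, 'n) covector_field \<Rightarrow> bool" where
  "one_form M \<A> b \<longleftrightarrow>
     (\<forall>p\<in>topspace M. linear_form_on_tangent \<A> p (b p)) \<and>
     (\<forall>c\<in>\<A>. \<forall>\<mu>. smooth_on (chart_range c) (form_comp \<A> c b \<mu>))"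

definition pseudo_riemannian_metric ::
    "'m topology \<Rightarrow> ('m, 'n::finite) chart set \<Rightarrow> ('m, 'n) bilinear_field \<Rightarrow> bool" where
  "pseudo_riemannian_metric M \<A> a \<longleftrightarrow>
     (\<forall>p\<in>topspace M.
        (\<forall>v\<in>tangent_space \<A> p. linear_form_on_tangent \<A> p (a p v)) \<and>
        (\<forall>v\<in>tangent_space \<A> p. \<forall>w\<in>tangent_space \<A> p. a p v w = a p w v) \<and>
        (\<forall>v\<in>tangent_space \<A> p. (\<forall>w\<in>tangent_space \<A> p. a p v w = 0) \<longrightarrow> v = tv_zero)) \<and>
     (\<forall>c\<in>\<A>. \<forall>\<mu> \<nu>. smooth_on (chart_range c) (metric_comp \<A> c a \<mu> \<nu>))"

text \<open>Coordinate formulas on an open subset of \<open>\<real>\<^sup>n\<close>, for \<open>h \<mu> \<nu>\<close> the components of a metric.\<close>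

definition pd :: "'n \<Rightarrow> (real ^ 'n::finite \<Rightarrow> real) \<Rightarrow> real ^ 'n \<Rightarrow> real" where
  "pd \<mu> f = (\<lambda>x. frechet_derivative f (at x) (axis \<mu> 1))"

definition inverse_comp :: "('n::finite \<Rightarrow> 'n \<Rightarrow> 'z \<Rightarrow> real) \<Rightarrow> 'n \<Rightarrow> 'n \<Rightarrow> 'z \<Rightarrow> real" where
  "inverse_comp h \<mu> \<nu> = (\<lambda>z. matrix_inv (\<chi> i j. h i j z) $ \<mu> $ \<nu>)"

definition christoffel ::
    "('n::finite \<Rightarrow> 'n \<Rightarrow> real ^ 'n \<Rightarrow> real) \<Rightarrow> 'n \<Rightarrow> 'n \<Rightarrow> 'n \<Rightarrow> real ^ 'n \<Rightarrow> real" where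
  "christoffel h \<rho> \<mu> \<nu> = (\<lambda>x. 1/2 * (\<Sum>\<sigma>\<in>UNIV. inverse_comp h \<rho> \<sigma> x *
     (pd \<mu> (h \<sigma> \<nu>) x + pd \<nu> (h \<mu> \<sigma>) x - pd \<sigma> (h \<mu> \<nu>) x)))"

definition ricci_comp ::
    "('n::finite \<Rightarrow> 'n \<Rightarrow> real ^ 'n \<Rightarrow> real) \<Rightarrow> 'n \<Rightarrow> 'n \<Rightarrow> real ^ 'n \<Rightarrow> real" where
  "ricci_comp h \<mu> \<nu> = (\<lambda>x. \<Sum>\<rho>\<in>UNIV.
     pd \<rho> (christoffel h \<rho> \<mu> \<nu>) x - pd \<nu> (christoffel h \<rho> \<mu> \<rho>) x +
     (\<Sum>\<sigma>\<in>UNIV. christoffel h \<rho> \<rho> \<sigma> x * christoffel h \<sigma> \<mu> \<nu> x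
        - christoffel h \<rho> \<nu> \<sigma> x * christoffel h \<sigma> \<mu> \<rho> x))"

definition solves_einstein_vacuum ::
    "('m, 'n::finite) chart set \<Rightarrow> ('m, 'n) bilinear_field \<Rightarrow> bool" where
  "solves_einstein_vacuum \<A> a \<longleftrightarrow>
     (\<forall>c\<in>\<A>. \<forall>x\<in>chart_range c. \<forall>\<mu> \<nu>. ricci_comp (metric_comp \<A> c a) \<mu> \<nu> x = 0)"

definition covariantly_constant ::
    "('m, 'n::finite) chart set \<Rightarrow> ('m, 'n) bilinear_field \<Rightarrow> ('m, 'n) covector_field \<Rightarrow> bool" where
  "covariantly_constant \<A> a b \<longleftrightarrow>
     (\<forall>c\<in>\<A>. \<forall>x\<in>chart_range c. \<forall>\<mu> \<nu>.
        pd \<mu> (form_comp \<A> c b \<nu>) x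
          - (\<Sum>\<rho>\<in>UNIV. christoffel (metric_comp \<A> c a) \<rho> \<mu> \<nu> x * form_comp \<A> c b \<rho> x) = 0)"

text \<open>An affine connection is given by its connection coefficients \<open>\<Gamma> c \<rho> \<mu> \<nu>\<close> in each chart \<open>c\<close>; the
  transformation law under changes of charts is not imposed.\<close>

type_synonym ('m, 'n) connection_coeffs =
  "('m, 'n) chart \<Rightarrow> 'n \<Rightarrow> 'n \<Rightarrow> 'n \<Rightarrow> real ^ 'n \<Rightarrow> real"

definition levi_civita ::
    "('m, 'n::finite) chart set \<Rightarrow> ('m, 'n) bilinear_field \<Rightarrow> ('m, 'n) connection_coeffs" where
  "levi_civita \<A> a = (\<lambda>c. christoffel (metric_comp \<A> c a))"


section \<open>Finsler geometry in the induced coordinates\<close>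

text \<open>Here \<open>z = (x, y)\<close>, and \<open>L\<close> is the square of the Finsler metric in the induced coordinates.\<close>

definition dx :: "'n \<Rightarrow> ('n::finite coords \<Rightarrow> real) \<Rightarrow> 'n coords \<Rightarrow> real" where
  "dx \<mu> f = (\<lambda>z. frechet_derivative f (at z) (axis \<mu> 1, 0))"

definition dy :: "'n \<Rightarrow> ('n::finite coords \<Rightarrow> real) \<Rightarrow> 'n coords \<Rightarrow> real" where
  "dy \<mu> f = (\<lambda>z. frechet_derivative f (at z) (0, axis \<mu> 1))"

context
  fixes L :: "'n::finite coords \<Rightarrow> real"
begin

definition fund_tensor :: "'n \<Rightarrow> 'n \<Rightarrow> 'n coords \<Rightarrow> real" where
  "fund_tensor \<mu> \<nu> = (\<lambda>z. 1/2 * dy \<mu> (dy \<nu> L) z)"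

definition fund_inv :: "'n \<Rightarrow> 'n \<Rightarrow> 'n coords \<Rightarrow> real" where
  "fund_inv = inverse_comp fund_tensor"

definition nonlinear_conn :: "'n \<Rightarrow> 'n \<Rightarrow> 'n coords \<Rightarrow> real" where
  "nonlinear_conn \<rho> \<mu> = (\<lambda>z. 1/4 * dy \<mu> (\<lambda>z. \<Sum>\<sigma>\<in>UNIV. fund_inv \<rho> \<sigma> z *
     ((\<Sum>\<kappa>\<in>UNIV. snd z $ \<kappa> * dx \<kappa> (dy \<sigma> L) z) - dx \<sigma> L z)) z)"

definition hor :: "'n \<Rightarrow> ('n coords \<Rightarrow> real) \<Rightarrow> 'n coords \<Rightarrow> real" where
  "hor \<mu> f = (\<lambda>z. dx \<mu> f z - (\<Sum>\<rho>\<in>UNIV. nonlinear_conn \<rho> \<mu> z * dy \<rho> f z))"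

definition spray :: "'n \<Rightarrow> 'n coords \<Rightarrow> real" where
  "spray \<rho> = (\<lambda>z. \<Sum>\<mu>\<in>UNIV. nonlinear_conn \<rho> \<mu> z * snd z $ \<mu>)"

definition nl_curvature :: "'n \<Rightarrow> 'n \<Rightarrow> 'n \<Rightarrow> 'n coords \<Rightarrow> real" where
  "nl_curvature \<rho> \<mu> \<nu> = (\<lambda>z. hor \<mu> (nonlinear_conn \<rho> \<nu>) z - hor \<nu> (nonlinear_conn \<rho> \<mu>) z)"

definition finsler_ric :: "'n coords \<Rightarrow> real" where
  "finsler_ric = (\<lambda>z. \<Sum>\<mu>\<in>UNIV. \<Sum>\<nu>\<in>UNIV. nl_curvature \<mu> \<mu> \<nu> z * snd z $ \<nu>)"

definition finsler_ricci :: "'n \<Rightarrow> 'n \<Rightarrow> 'n coords \<Rightarrow> real" where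
  "finsler_ricci \<mu> \<nu> = (\<lambda>z. 1/2 * dy \<mu> (dy \<nu> finsler_ric) z)"

definition y_low :: "'n \<Rightarrow> 'n coords \<Rightarrow> real" where
  "y_low \<sigma> = (\<lambda>z. \<Sum>\<kappa>\<in>UNIV. fund_tensor \<sigma> \<kappa> z * snd z $ \<kappa>)"

definition landsberg :: "'n \<Rightarrow> 'n \<Rightarrow> 'n \<Rightarrow> 'n coords \<Rightarrow> real" where
  "landsberg \<mu> \<nu> \<rho> = (\<lambda>z. - 1/4 * (\<Sum>\<sigma>\<in>UNIV. y_low \<sigma> z * dy \<mu> (dy \<nu> (dy \<rho> (spray \<sigma>))) z))"

definition mean_landsberg :: "'n \<Rightarrow> 'n coords \<Rightarrow> real" where
  "mean_landsberg \<mu> = (\<lambda>z. \<Sum>\<nu>\<in>UNIV. \<Sum>\<rho>\<in>UNIV. fund_inv \<nu> \<rho> z * landsberg \<mu> \<nu> \<rho> z)"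

definition dyn_mean_landsberg :: "'n \<Rightarrow> 'n coords \<Rightarrow> real" where
  "dyn_mean_landsberg \<nu> = (\<lambda>z. \<Sum>\<rho>\<in>UNIV.
     snd z $ \<rho> * hor \<rho> (mean_landsberg \<nu>) z - nonlinear_conn \<rho> \<nu> z * mean_landsberg \<rho> z)"

definition chern_christoffel :: "'n \<Rightarrow> 'n \<Rightarrow> 'n \<Rightarrow> 'n coords \<Rightarrow> real" where
  "chern_christoffel \<rho> \<mu> \<nu> = (\<lambda>z. 1/2 * (\<Sum>\<sigma>\<in>UNIV. fund_inv \<rho> \<sigma> z *
     (hor \<mu> (fund_tensor \<sigma> \<nu>) z + hor \<nu> (fund_tensor \<mu> \<sigma>) z - hor \<sigma> (fund_tensor \<mu> \<nu>) z)))"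

definition chern_mean_landsberg :: "'n \<Rightarrow> 'n \<Rightarrow> 'n coords \<Rightarrow> real" where
  "chern_mean_landsberg \<mu> \<nu> = (\<lambda>z. hor \<mu> (mean_landsberg \<nu>) z
     - (\<Sum>\<rho>\<in>UNIV. chern_christoffel \<rho> \<mu> \<nu> z * mean_landsberg \<rho> z))"

end

text \<open>The coefficients are those of dimension 4.\<close>

definition field_equation_lhs :: "(4 coords \<Rightarrow> real) \<Rightarrow> 4 coords \<Rightarrow> real" where
  "field_equation_lhs L = (\<lambda>z.
     - 2 * finsler_ric L z
     + 2 * L z / 3 * (\<Sum>\<mu>\<in>UNIV. \<Sum>\<nu>\<in>UNIV. fund_inv L \<mu> \<nu> z * finsler_ricci L \<mu> \<nu> z)
     + 2 * L z / 3 * (\<Sum>\<mu>\<in>UNIV. \<Sum>\<nu>\<in>UNIV. fund_inv L \<mu> \<nu> z *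
         (dy \<mu> (dyn_mean_landsberg L \<nu>) z - mean_landsberg L \<mu> z * mean_landsberg L \<nu> z
          + chern_mean_landsberg L \<mu> \<nu> z)))"


section \<open>Finsler metrics on a manifold\<close>

definition conic_subbundle ::
    "'m topology \<Rightarrow> ('m, 'n::finite) chart set \<Rightarrow> ('m, 'n) tpoint set \<Rightarrow> bool" where
  "conic_subbundle M \<A> A \<longleftrightarrow>
     A \<subseteq> tangent_bundle M \<A> \<and>
     (\<forall>c\<in>\<A>. open (local_set \<A> c A)) \<and>
     fst ` A = topspace M \<and>
     (\<forall>p v r. (p, v) \<in> A \<and> r > 0 \<longrightarrow> (p, tv_scale r v) \<in> A)"

definition local_lagrangian ::
    "('m, 'n::finite) chart set \<Rightarrow> ('m, 'n) chart \<Rightarrow> (('m, 'n) tpoint \<Rightarrow> real)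
       \<Rightarrow> 'n coords \<Rightarrow> real" where
  "local_lagrangian \<A> c F = (\<lambda>z. (local_fun \<A> c F z)\<^sup>2)"

definition finsler_metric ::
    "'m topology \<Rightarrow> ('m, 'n::finite) chart set \<Rightarrow> ('m, 'n) tpoint set
       \<Rightarrow> (('m, 'n) tpoint \<Rightarrow> real) \<Rightarrow> bool" where
  "finsler_metric M \<A> A F \<longleftrightarrow>
     conic_subbundle M \<A> A \<and>
     (\<forall>c\<in>\<A>. smooth_on (local_set \<A> c A) (local_fun \<A> c F)) \<and>
     (\<forall>p v r. (p, v) \<in> A \<and> r > 0 \<longrightarrow> F (p, tv_scale r v) = r * F (p, v)) \<and>
     (\<forall>c\<in>\<A>. \<forall>z\<in>local_set \<A> c A.
        invertible (\<chi> \<mu> \<nu>. fund_tensor (local_lagrangian \<A> c F) \<mu> \<nu> z))"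

text \<open>The function \<open>\<phi>\<close> need only be defined on an open set \<open>D\<close> containing the values of
  \<open>\<beta>/\<alpha>\<close>; this admits, e.g., Kropina metrics, where \<open>\<phi> s = 1/s\<close>.\<close>

definition alpha_beta_metric ::
    "'m topology \<Rightarrow> ('m, 'n::finite) chart set \<Rightarrow> ('m, 'n) tpoint set \<Rightarrow> (('m, 'n) tpoint \<Rightarrow> real)
       \<Rightarrow> ('m, 'n) bilinear_field \<Rightarrow> ('m, 'n) covector_field \<Rightarrow> bool" where
  "alpha_beta_metric M \<A> A F a b \<longleftrightarrow>
     pseudo_riemannian_metric M \<A> a \<and> one_form M \<A> b \<and> finsler_metric M \<A> A F \<and>
     (\<exists>D \<phi>. open D \<and> smooth_on D \<phi> \<and>
        (\<forall>(p, v)\<in>A.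
           let \<alpha> = sqrt \<bar>a p v v\<bar>; \<beta> = b p v
           in \<alpha> \<noteq> 0 \<and> \<beta> / \<alpha> \<in> D \<and> F (p, v) = \<alpha> * \<phi> (\<beta> / \<alpha>)))"

definition ricci_flat ::
    "('m, 'n::finite) chart set \<Rightarrow> ('m, 'n) tpoint set \<Rightarrow> (('m, 'n) tpoint \<Rightarrow> real) \<Rightarrow> bool" where
  "ricci_flat \<A> A F \<longleftrightarrow>
     (\<forall>c\<in>\<A>. \<forall>z\<in>local_set \<A> c A. \<forall>\<mu> \<nu>. finsler_ricci (local_lagrangian \<A> c F) \<mu> \<nu> z = 0)"

definition finsler_vacuum_solution ::
    "('m, 4) chart set \<Rightarrow> ('m, 4) tpoint set \<Rightarrow> (('m, 4) tpoint \<Rightarrow> real) \<Rightarrow> bool" where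
  "finsler_vacuum_solution \<A> A F \<longleftrightarrow>
     (\<forall>c\<in>\<A>. \<forall>z\<in>local_set \<A> c A. field_equation_lhs (local_lagrangian \<A> c F) z = 0)"

definition is_affine_connection_of ::
    "('m, 'n::finite) chart set \<Rightarrow> ('m, 'n) tpoint set \<Rightarrow> (('m, 'n) tpoint \<Rightarrow> real)
       \<Rightarrow> ('m, 'n) connection_coeffs \<Rightarrow> bool" where
  "is_affine_connection_of \<A> A F \<Gamma> \<longleftrightarrow>
     (\<forall>c\<in>\<A>. \<forall>z\<in>local_set \<A> c A. \<forall>\<rho> \<mu>.
        nonlinear_conn (local_lagrangian \<A> c F) \<rho> \<mu> z
          = (\<Sum>\<nu>\<in>UNIV. \<Gamma> c \<rho> \<mu> \<nu> (fst z) * snd z $ \<nu>))"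

definition berwald_type ::
    "('m, 'n::finite) chart set \<Rightarrow> ('m, 'n) tpoint set \<Rightarrow> (('m, 'n) tpoint \<Rightarrow> real) \<Rightarrow> bool" where
  "berwald_type \<A> A F \<longleftrightarrow> (\<exists>\<Gamma>. is_affine_connection_of \<A> A F \<Gamma>)"

definition same_connection ::
    "('m, 'n::finite) chart set \<Rightarrow> ('m, 'n) connection_coeffs \<Rightarrow> ('m, 'n) connection_coeffs \<Rightarrow> bool" where
  "same_connection \<A> \<Gamma> \<Gamma>' \<longleftrightarrow>
     (\<forall>c\<in>\<A>. \<forall>x\<in>chart_range c. \<forall>\<rho> \<mu> \<nu>. \<Gamma> c \<rho> \<mu> \<nu> x = \<Gamma>' c \<rho> \<mu> \<nu> x)"

end

theory Submission
  imports Defs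
begin

text \<open>Let \<open>N\<^sup>\<rho>\<^sub>\<mu> = \<Gamma>\<^sup>\<rho>\<^sub>\<mu>\<^sub>\<nu> y\<^sup>\<nu>\<close> with \<open>\<Gamma>\<close> the Levi-Civita connection of \<open>a\<close>. Metric compatibility and the
  parallelism of \<open>b\<close> say that \<open>a(y, y)\<close> and \<open>\<beta>\<close> are annihilated by \<open>\<partial>\<^sub>\<mu> - N\<^sup>\<rho>\<^sub>\<mu> \<partial>/\<partial>y\<^sup>\<rho>\<close>, hence so is
  \<open>L\<close>, which is locally a function of these two. Differentiating this identity along the fibre and
  using the symmetry of second derivatives shows that the Euler-Lagrange expression of \<open>L\<close> equals
  \<open>2 g\<^sub>\<sigma>\<^sub>\<rho> N\<^sup>\<rho>\<^sub>\<kappa> y\<^sup>\<kappa>\<close>, so that the canonical nonlinear connection is \<open>N\<close>. As \<open>N\<close> is linear in \<open>y\<close>, the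
  Landsberg terms vanish, and the Finslerian Ricci scalar is the Ricci tensor of \<open>a\<close> evaluated on
  \<open>(y, y)\<close>, which is zero.\<close>

section \<open>Smooth functions\<close>

lemma times_differentiable_on_SucD:
  "times_differentiable_on (Suc k) S f \<Longrightarrow> times_differentiable_on k S f"
proof (induction k arbitrary: f)
  case 0
  then show ?case
    by (auto intro: continuous_at_imp_continuous_on differentiable_imp_continuous_within)
next
  case (Suc k)
  then show ?case by (metis times_differentiable_on.simps(2))
qed

text \<open>Both functions have the same derivatives at \<open>x\<close>, so the choice operator
  inside \<open>frechet_derivative\<close> returns the same map, even where no derivative exists.
  Identities on an open set may therefore be substituted under \<open>dx\<close> and
  \<open>dy\<close>.\<close>

lemma frechet_derivative_cong_open:
  assumes "open S" "x \<in> S" "\<And>x. x \<in> S \<Longrightarrow> f x = g x"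
  shows "frechet_derivative f (at x) = frechet_derivative g (at x)"
proof -
  have "(f has_derivative D) (at x) \<longleftrightarrow> (g has_derivative D) (at x)" for D
    using assms by (metis has_derivative_transform_within_open)
  then show ?thesis by (simp add: frechet_derivative_def)
qed

lemma times_differentiable_on_cong:
  assumes "open S" "\<And>x. x \<in> S \<Longrightarrow> f x = g x"
  shows "times_differentiable_on k S f \<longleftrightarrow> times_differentiable_on k S g"
  using assms
proof (induction k arbitrary: f g)
  case 0
  then show ?case by (simp cong: continuous_on_cong)
next
  case (Suc k)
  have "f differentiable (at x) \<longleftrightarrow> g differentiable (at x)" if "x \<in> S" for x
    unfolding differentiable_def using Suc.prems that
    by (metis has_derivative_transform_within_open)
  moreover have "times_differentiable_on k S (\<lambda>x. frechet_derivative f (at x) v)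
      \<longleftrightarrow> times_differentiable_on k S (\<lambda>x. frechet_derivative g (at x) v)" for v
    using Suc.prems frechet_derivative_cong_open[of S _ f g] by (intro Suc.IH) auto
  ultimately show ?case by simp
qed

lemma times_differentiable_on_add:
  assumes "open S" "times_differentiable_on k S f" "times_differentiable_on k S g"
  shows "times_differentiable_on k S (\<lambda>x. f x + g x)"
  using assms
proof (induction k arbitrary: f g)
  case 0
  then show ?case by (simp add: continuous_on_add)
next
  case (Suc k)
  have D: "frechet_derivative (\<lambda>x. f x + g x) (at x)
      = (\<lambda>v. frechet_derivative f (at x) v + frechet_derivative g (at x) v)" if "x \<in> S" for x
    using Suc.prems that
    by (intro frechet_derivative_at[symmetric] has_derivative_add) (auto simp: frechet_derivative_works)
  have "times_differentiable_on k S (\<lambda>x. frechet_derivative (\<lambda>x. f x + g x) (at x) v)" for v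
    using Suc.IH[of "\<lambda>x. frechet_derivative f (at x) v" "\<lambda>x. frechet_derivative g (at x) v"]
      Suc.prems D by (subst times_differentiable_on_cong[OF Suc.prems(1)]) auto
  then show ?case using Suc.prems by auto
qed

text \<open>The product rule leaves \<open>f\<close> and \<open>g\<close> undifferentiated beside
  derivatives of order one less; \<open>times_differentiable_on_SucD\<close> brings all factors to
  the common order \<open>k\<close>.\<close>

lemma times_differentiable_on_mult:
  fixes f g :: "'a::real_normed_vector \<Rightarrow> real"
  assumes "open S" "times_differentiable_on k S f" "times_differentiable_on k S g"
  shows "times_differentiable_on k S (\<lambda>x. f x * g x)"
  using assms
proof (induction k arbitrary: f g)
  case 0
  then show ?case by (simp add: continuous_on_mult)
next
  case (Suc k)
  have D: "frechet_derivative (\<lambda>x. f x * g x) (at x)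
      = (\<lambda>v. f x * frechet_derivative g (at x) v + frechet_derivative f (at x) v * g x)"
    if "x \<in> S" for x
    using Suc.prems that
    by (intro frechet_derivative_at[symmetric] has_derivative_mult) (auto simp: frechet_derivative_works)
  have "times_differentiable_on k S
      (\<lambda>x. f x * frechet_derivative g (at x) v + frechet_derivative f (at x) v * g x)" for v
    using Suc.prems times_differentiable_on_SucD
    by (intro times_differentiable_on_add Suc.IH) auto
  then have "times_differentiable_on k S (\<lambda>x. frechet_derivative (\<lambda>x. f x * g x) (at x) v)" for v
    using D by (subst times_differentiable_on_cong[OF Suc.prems(1)]) auto
  then show ?case using Suc.prems by auto
qed

lemma smooth_on_mult:
  fixes f g :: "'a::real_normed_vector \<Rightarrow> real"
  shows "open S \<Longrightarrow> smooth_on S f \<Longrightarrow> smooth_on S g \<Longrightarrow> smooth_on S (\<lambda>x. f x * g x)"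
  by (simp add: smooth_on_def times_differentiable_on_mult)

lemma smooth_on_differentiable: "smooth_on S f \<Longrightarrow> x \<in> S \<Longrightarrow> f differentiable (at x)"
  unfolding smooth_on_def by (metis times_differentiable_on.simps(2))

lemma smooth_on_derivative:
  "smooth_on S f \<Longrightarrow> smooth_on S (\<lambda>x. frechet_derivative f (at x) v)"
  unfolding smooth_on_def by (metis times_differentiable_on.simps(2))

lemma smooth_on_continuous: "smooth_on S f \<Longrightarrow> continuous_on S f"
  unfolding smooth_on_def by (metis times_differentiable_on.simps(1))

section \<open>Symmetry of second derivatives\<close>

text \<open>The mean value theorem is applied twice: first in \<open>s\<close> to the difference
  \<open>p\<close> of \<open>f\<close> across the side \<open>h *\<^sub>R w\<close>, then in
  \<open>t\<close> to the derivative of \<open>f\<close> along \<open>v\<close>.\<close>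

lemma second_difference_mean_value:
  fixes f :: "'a::real_normed_vector \<Rightarrow> real"
  assumes f: "smooth_on S f" and h: "h > 0"
    and S: "\<And>s t. 0 \<le> s \<Longrightarrow> s \<le> h \<Longrightarrow> 0 \<le> t \<Longrightarrow> t \<le> h \<Longrightarrow> x + s *\<^sub>R v + t *\<^sub>R w \<in> S"
  obtains s t where "0 \<le> s" "s \<le> h" "0 \<le> t" "t \<le> h"
    "f (x + h *\<^sub>R v + h *\<^sub>R w) - f (x + h *\<^sub>R v) - f (x + h *\<^sub>R w) + f x
       = h * h * frechet_derivative (\<lambda>x. frechet_derivative f (at x) v) (at (x + s *\<^sub>R v + t *\<^sub>R w)) w"
proof -
  let ?D = "\<lambda>y. frechet_derivative f (at y)"
  let ?g = "\<lambda>y. ?D y v"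
  let ?E = "\<lambda>y. frechet_derivative ?g (at y)"
  have Df: "(f has_derivative ?D y) (at y)" if "y \<in> S" for y
    using smooth_on_differentiable[OF f that] by (simp add: frechet_derivative_works)
  have Dg: "(?g has_derivative ?E y) (at y)" if "y \<in> S" for y
    using smooth_on_differentiable[OF smooth_on_derivative[OF f] that]
    by (simp add: frechet_derivative_works)
  have "((\<lambda>s. f (x + s *\<^sub>R v + t *\<^sub>R w)) has_real_derivative ?g (x + s *\<^sub>R v + t *\<^sub>R w)) (at s)"
    if "0 \<le> s" "s \<le> h" "0 \<le> t" "t \<le> h" for s t
  proof -
    have "((\<lambda>s. f (x + s *\<^sub>R v + t *\<^sub>R w)) has_derivative
        (\<lambda>r. ?D (x + s *\<^sub>R v + t *\<^sub>R w) (r *\<^sub>R v))) (at s)"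
      using S[OF that] by (intro has_derivative_compose[OF _ Df]) (auto intro!: derivative_eq_intros)
    moreover have "linear (?D (x + s *\<^sub>R v + t *\<^sub>R w))"
      using Df[OF S[OF that]] has_derivative_linear by blast
    ultimately show ?thesis
      by (simp add: has_field_derivative_def linear_cmul mult.commute[of "?g _"] mult_commute_abs)
  qed note D1 = this
  have "((\<lambda>t. ?g (x + s *\<^sub>R v + t *\<^sub>R w)) has_real_derivative ?E (x + s *\<^sub>R v + t *\<^sub>R w) w) (at t)"
    if "0 \<le> s" "s \<le> h" "0 \<le> t" "t \<le> h" for s t
  proof -
    have "((\<lambda>t. ?g (x + s *\<^sub>R v + t *\<^sub>R w)) has_derivative
        (\<lambda>r. ?E (x + s *\<^sub>R v + t *\<^sub>R w) (r *\<^sub>R w))) (at t)"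
      using S[OF that] by (intro has_derivative_compose[OF _ Dg]) (auto intro!: derivative_eq_intros)
    moreover have "linear (?E (x + s *\<^sub>R v + t *\<^sub>R w))"
      using Dg[OF S[OF that]] has_derivative_linear by blast
    ultimately show ?thesis
      by (simp add: has_field_derivative_def linear_cmul mult_commute_abs)
  qed note D2 = this
  \<comment> \<open>The summand \<open>0 *\<^sub>R w\<close> keeps both terms in the shape to which
    \<open>D1\<close> and \<open>D2\<close> apply.\<close>
  define p where "p = (\<lambda>s. f (x + s *\<^sub>R v + h *\<^sub>R w) - f (x + s *\<^sub>R v + 0 *\<^sub>R w))"
  define p' where "p' = (\<lambda>s. ?g (x + s *\<^sub>R v + h *\<^sub>R w) - ?g (x + s *\<^sub>R v + 0 *\<^sub>R w))"
  have "(p has_real_derivative p' s) (at s)"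
    if "0 \<le> s" "s \<le> h" for s
    unfolding p_def p'_def using that h by (intro DERIV_diff D1) auto
  then obtain s where s: "0 < s" "s < h"
    "p h - p 0 = (h - 0) * p' s"
    using MVT2[OF h, of p p'] by blast
  have "\<exists>t>0. t < h \<and> ?g (x + s *\<^sub>R v + h *\<^sub>R w) - ?g (x + s *\<^sub>R v + 0 *\<^sub>R w)
      = (h - 0) * ?E (x + s *\<^sub>R v + t *\<^sub>R w) w"
    using s by (intro MVT2[OF h] D2) auto
  then obtain t where t: "0 < t" "t < h"
    "?g (x + s *\<^sub>R v + h *\<^sub>R w) - ?g (x + s *\<^sub>R v + 0 *\<^sub>R w)
      = (h - 0) * ?E (x + s *\<^sub>R v + t *\<^sub>R w) w"
    by blast
  have "p h - p 0 = h * h * ?E (x + s *\<^sub>R v + t *\<^sub>R w) w"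
    using s(3) t(3) by (simp add: p'_def)
  moreover have "p h - p 0 = f (x + h *\<^sub>R v + h *\<^sub>R w) - f (x + h *\<^sub>R v) - f (x + h *\<^sub>R w) + f x"
    by (simp add: p_def)
  ultimately show ?thesis using that[of s t] s t by auto
qed

text \<open>The second difference of \<open>f\<close> over a small parallelogram is unchanged when
  \<open>v\<close> and \<open>w\<close> are exchanged, and it is \<open>h * h\<close> times either
  mixed derivative at some point of the parallelogram. By continuity of both mixed derivatives their
  values at \<open>x\<close> then differ by at most any given \<open>e\<close>.\<close>

lemma smooth_on_second_derivative_symmetric:
  fixes f :: "'a::real_normed_vector \<Rightarrow> real"
  assumes "open S" and f: "smooth_on S f" and x: "x \<in> S"
  shows "frechet_derivative (\<lambda>x. frechet_derivative f (at x) v) (at x) w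
    = frechet_derivative (\<lambda>x. frechet_derivative f (at x) w) (at x) v"
proof -
  let ?P = "\<lambda>v w y. frechet_derivative (\<lambda>x. frechet_derivative f (at x) v) (at y) w"
  have cont: "continuous (at x) (?P v w)" for v w
    using smooth_on_continuous[OF smooth_on_derivative[OF smooth_on_derivative[OF f]]] assms
    by (simp add: continuous_on_eq_continuous_at)
  have "\<bar>?P v w x - ?P w v x\<bar> \<le> e" if "e > 0" for e
  proof -
    obtain d1 where d1: "d1 > 0" "\<And>y. dist y x < d1 \<Longrightarrow> dist (?P v w y) (?P v w x) < e / 2"
      using cont[of v w] \<open>e > 0\<close> unfolding continuous_at_eps_delta
      by (metis half_gt_zero dist_norm)
    obtain d2 where d2: "d2 > 0" "\<And>y. dist y x < d2 \<Longrightarrow> dist (?P w v y) (?P w v x) < e / 2"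
      using cont[of w v] \<open>e > 0\<close> unfolding continuous_at_eps_delta
      by (metis half_gt_zero dist_norm)
    obtain d3 where d3: "d3 > 0" "\<And>y. dist y x < d3 \<Longrightarrow> y \<in> S"
      using \<open>open S\<close> x by (metis open_dist)
    define d where "d = Min {d1, d2, d3}"
    have d: "d > 0" "d \<le> d1" "d \<le> d2" "d \<le> d3" using d1 d2 d3 by (auto simp: d_def)
    \<comment> \<open>With this side length every point of the parallelogram lies within
      \<open>d\<close> of \<open>x\<close>; the summand 1 keeps the denominator positive when both
      vectors vanish.\<close>
    define h where "h = d / (norm v + norm w + 1)"
    have h: "h > 0" using d by (simp add: h_def add_nonneg_pos)
    have close: "dist (x + s *\<^sub>R v + t *\<^sub>R w) x < d" if "0 \<le> s" "s \<le> h" "0 \<le> t" "t \<le> h" for s t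
    proof -
      have "norm (s *\<^sub>R v + t *\<^sub>R w) \<le> h * norm v + h * norm w"
        using that by (intro norm_triangle_le add_mono) (auto simp: mult_right_mono)
      also have "\<dots> < h * (norm v + norm w + 1)" using h by (simp add: algebra_simps)
      also have "\<dots> = d" by (simp add: h_def add_nonneg_pos less_imp_neq[symmetric])
      finally show ?thesis by (simp add: dist_norm add.assoc)
    qed
    have S: "x + s *\<^sub>R v + t *\<^sub>R w \<in> S" if "0 \<le> s" "s \<le> h" "0 \<le> t" "t \<le> h" for s t
      using close[OF that] d d3 by force
    obtain s t where st: "0 \<le> s" "s \<le> h" "0 \<le> t" "t \<le> h"
      "f (x + h *\<^sub>R v + h *\<^sub>R w) - f (x + h *\<^sub>R v) - f (x + h *\<^sub>R w) + f x
       = h * h * ?P v w (x + s *\<^sub>R v + t *\<^sub>R w)"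
      using second_difference_mean_value[OF f h, of x v w] S by blast
    have S': "x + s *\<^sub>R w + t *\<^sub>R v \<in> S" if "0 \<le> s" "s \<le> h" "0 \<le> t" "t \<le> h" for s t
      using S[of t s] that by (simp add: algebra_simps)
    obtain s' t' where st': "0 \<le> s'" "s' \<le> h" "0 \<le> t'" "t' \<le> h"
      "f (x + h *\<^sub>R w + h *\<^sub>R v) - f (x + h *\<^sub>R w) - f (x + h *\<^sub>R v) + f x
       = h * h * ?P w v (x + s' *\<^sub>R w + t' *\<^sub>R v)"
      using second_difference_mean_value[OF f h, of x w v] S' by blast
    have "h * h * ?P v w (x + s *\<^sub>R v + t *\<^sub>R w) = h * h * ?P w v (x + s' *\<^sub>R w + t' *\<^sub>R v)"
      using st(5) st'(5) by (simp add: algebra_simps)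
    then have eq: "?P v w (x + s *\<^sub>R v + t *\<^sub>R w) = ?P w v (x + s' *\<^sub>R w + t' *\<^sub>R v)"
      using h by simp
    have "dist (?P v w (x + s *\<^sub>R v + t *\<^sub>R w)) (?P v w x) < e / 2"
      using close[OF st(1-4)] d by (intro d1) simp
    moreover have "dist (?P w v (x + s' *\<^sub>R w + t' *\<^sub>R v)) (?P w v x) < e / 2"
      using close[OF st'(3,4,1,2)] d by (intro d2) (simp add: algebra_simps)
    ultimately have "dist (?P v w x) (?P w v x) < e"
      unfolding eq by (metis dist_commute dist_triangle_half_r)
    then show ?thesis by (simp add: dist_real_def)
  qed
  then show ?thesis using field_le_epsilon[of "\<bar>?P v w x - ?P w v x\<bar>" 0] by simp
qed

section \<open>Differentiability of the inverse of a matrix of functions\<close>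

lemma differentiable_det:
  fixes A :: "'a::real_normed_vector \<Rightarrow> real ^ 'n ^ 'n::finite"
  assumes "\<And>i j. (\<lambda>x. A x $ i $ j) differentiable (at x)"
  shows "(\<lambda>x. det (A x)) differentiable (at x)"
proof -
  have "(\<lambda>x. \<Prod>i\<in>I. A x $ i $ p i) differentiable (at x)" for I and p :: "'n \<Rightarrow> 'n"
    by (induction I rule: infinite_finite_induct) (auto intro!: differentiable_mult assms)
  then show ?thesis unfolding det_def by (intro differentiable_sum differentiable_mult) auto
qed

lemma matrix_inv_cancel:
  fixes A :: "'a::semiring_1 ^ 'n ^ 'n"
  assumes "invertible A"
  shows "A ** matrix_inv A = mat 1" "matrix_inv A ** A = mat 1"
  using someI_ex[of "\<lambda>B. A ** B = mat 1 \<and> B ** A = mat 1"] assms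
  by (auto simp: invertible_def matrix_inv_def)

text \<open>\<open>matrix_inv\<close> is defined by choice, so it is replaced on \<open>S\<close> by
  a formula: column \<open>\<nu>\<close> of the inverse solves the linear system with right-hand
  side \<open>axis \<nu> 1\<close>, and Cramer's rule gives its component \<open>\<mu>\<close> as a
  quotient of determinants, which are polynomials in the entries.\<close>

lemma differentiable_inverse_comp:
  fixes h :: "'n::finite \<Rightarrow> 'n \<Rightarrow> 'a::real_normed_vector \<Rightarrow> real"
  assumes "open S" "x \<in> S"
    and h: "\<And>i j. h i j differentiable (at x)"
    and inv: "\<And>x. x \<in> S \<Longrightarrow> invertible (\<chi> i j. h i j x)"
  shows "inverse_comp h \<mu> \<nu> differentiable (at x)"
proof -
  let ?A = "\<lambda>x. (\<chi> i j. h i j x) :: real ^ 'n ^ 'n"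
  let ?B = "\<lambda>x. (\<chi> i j. if j = \<mu> then axis \<nu> 1 $ i else ?A x $ i $ j) :: real ^ 'n ^ 'n"
  have cramer_rule: "inverse_comp h \<mu> \<nu> y = det (?B y) / det (?A y)" if "y \<in> S" for y
  proof -
    have "?A y ** matrix_inv (?A y) = mat 1" using inv[OF that] by (rule matrix_inv_cancel)
    then have "?A y *v (matrix_inv (?A y) *v axis \<nu> 1) = axis \<nu> 1"
      by (simp add: matrix_vector_mul_assoc)
    then have "matrix_inv (?A y) *v axis \<nu> 1
        = (\<chi> k. det (\<chi> i j. if j = k then axis \<nu> 1 $ i else ?A y $ i $ j) / det (?A y))"
      by (rule iffD1[OF cramer[OF inv[OF that, unfolded invertible_det_nz]]])
    then have "(matrix_inv (?A y) *v axis \<nu> 1) $ \<mu> = det (?B y) / det (?A y)"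
      by simp
    then show ?thesis
      by (simp add: inverse_comp_def matrix_vector_mul_component inner_axis)
  qed
  have "(\<lambda>x. ?B x $ i $ j) differentiable (at x)" for i j
    using h by (cases "j = \<mu>") simp_all
  then have "(\<lambda>x. det (?B x)) differentiable (at x)"
    by (rule differentiable_det)
  moreover have "(\<lambda>x. det (?A x)) differentiable (at x)"
    using h by (intro differentiable_det) simp
  moreover have "det (?A x) \<noteq> 0" using inv[OF \<open>x \<in> S\<close>] by (simp add: invertible_det_nz)
  ultimately have "(\<lambda>x. det (?B x) / det (?A x)) differentiable (at x)"
    by (intro differentiable_divide)
  then obtain D where "((\<lambda>x. det (?B x) / det (?A x)) has_derivative D) (at x)"
    by (auto simp: differentiable_def)
  then have "(inverse_comp h \<mu> \<nu> has_derivative D) (at x)"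
    by (rule has_derivative_transform_within_open[OF _ assms(1,2)]) (simp add: cramer_rule)
  then show ?thesis by (auto simp: differentiable_def)
qed

section \<open>Lagrangians constant along a linear connection\<close>

lemma dx_eqI: "(f has_derivative f') (at z) \<Longrightarrow> dx \<mu> f z = f' (axis \<mu> 1, 0)"
  unfolding dx_def by (metis frechet_derivative_at)

lemma dy_eqI: "(f has_derivative f') (at z) \<Longrightarrow> dy \<mu> f z = f' (0, axis \<mu> 1)"
  unfolding dy_def by (metis frechet_derivative_at)

lemma has_derivative_fibre_coordinate [derivative_intros]:
  "((\<lambda>z. snd z $ \<nu>) has_derivative (\<lambda>h. snd h $ \<nu>)) (at (z :: 'n::finite coords))"
  by (intro bounded_linear_imp_has_derivative bounded_linear_compose[OF bounded_linear_vec_nth]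
      bounded_linear_snd)

lemma has_derivative_base_function:
  assumes "f differentiable (at (fst z))"
  shows "((\<lambda>z. f (fst z)) has_derivative (\<lambda>h. frechet_derivative f (at (fst z)) (fst h))) (at z)"
  by (rule has_derivative_compose[OF has_derivative_fst[OF has_derivative_ident]
        assms[unfolded frechet_derivative_works]])

lemma dx_cong_open:
  "open U \<Longrightarrow> z \<in> U \<Longrightarrow> (\<And>z. z \<in> U \<Longrightarrow> f z = g z) \<Longrightarrow> dx \<mu> f z = dx \<mu> g z"
  unfolding dx_def by (metis frechet_derivative_cong_open)

lemma dy_cong_open:
  "open U \<Longrightarrow> z \<in> U \<Longrightarrow> (\<And>z. z \<in> U \<Longrightarrow> f z = g z) \<Longrightarrow> dy \<mu> f z = dy \<mu> g z"
  unfolding dy_def by (metis frechet_derivative_cong_open)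

lemma dx_zero_open: "open U \<Longrightarrow> z \<in> U \<Longrightarrow> (\<And>z. z \<in> U \<Longrightarrow> f z = 0) \<Longrightarrow> dx \<mu> f z = 0"
  using dx_cong_open[of U z f "\<lambda>_. 0"] by (simp add: dx_def)

lemma dy_const_open: "open U \<Longrightarrow> z \<in> U \<Longrightarrow> (\<And>z. z \<in> U \<Longrightarrow> f z = c) \<Longrightarrow> dy \<mu> f z = 0"
  using dy_cong_open[of U z f "\<lambda>_. c"] by (simp add: dy_def)

lemma sum_axis_mult [simp]:
  fixes f :: "'n::finite \<Rightarrow> real"
  shows "(\<Sum>\<nu>\<in>UNIV. f \<nu> * axis \<mu> 1 $ \<nu>) = f \<mu>" "(\<Sum>\<nu>\<in>UNIV. axis \<mu> 1 $ \<nu> * f \<nu>) = f \<mu>"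
  by (simp_all add: axis_def if_distrib if_distribR cong: if_cong)

lemma sum_inverse_comp:
  fixes g :: "'n::finite \<Rightarrow> 'n \<Rightarrow> 'z \<Rightarrow> real"
  assumes "invertible (\<chi> i j. g i j z)"
  shows "(\<Sum>\<sigma>\<in>UNIV. inverse_comp g \<tau> \<sigma> z * g \<sigma> \<rho> z) = (if \<tau> = \<rho> then 1 else 0)"
    and "(\<Sum>\<sigma>\<in>UNIV. g \<tau> \<sigma> z * inverse_comp g \<sigma> \<rho> z) = (if \<tau> = \<rho> then 1 else 0)"
  using matrix_inv_cancel[OF assms]
  by (auto simp: inverse_comp_def matrix_matrix_mult_def mat_def vec_eq_iff)

section \<open>Connections linear in the fibre coordinates\<close>

text \<open>Of the Levi-Civita coefficients only symmetry and differentiability enter the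
  connection, curvature and Landsberg computations. Metric compatibility is kept apart, since it
  serves only to show that \<open>L\<close> is horizontally constant.\<close>

locale symmetric_connection =
  fixes X :: "(real ^ 'n::finite) set" and \<Gamma> :: "'n \<Rightarrow> 'n \<Rightarrow> 'n \<Rightarrow> real ^ 'n \<Rightarrow> real"
  assumes open_X: "open X"
    and \<Gamma>_sym: "x \<in> X \<Longrightarrow> \<Gamma> \<rho> \<mu> \<nu> x = \<Gamma> \<rho> \<nu> \<mu> x"
    and \<Gamma>_diff: "x \<in> X \<Longrightarrow> \<Gamma> \<rho> \<mu> \<nu> differentiable (at x)"
begin

definition N :: "'n \<Rightarrow> 'n \<Rightarrow> 'n coords \<Rightarrow> real" where
  "N \<rho> \<mu> z = (\<Sum>\<nu>\<in>UNIV. \<Gamma> \<rho> \<mu> \<nu> (fst z) * snd z $ \<nu>)"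

lemma N_has_derivative:
  assumes "fst z \<in> X"
  shows "(N \<rho> \<mu> has_derivative (\<lambda>h. \<Sum>\<nu>\<in>UNIV. \<Gamma> \<rho> \<mu> \<nu> (fst z) * snd h $ \<nu>
    + frechet_derivative (\<Gamma> \<rho> \<mu> \<nu>) (at (fst z)) (fst h) * snd z $ \<nu>)) (at z)"
  unfolding N_def
  by (intro has_derivative_sum has_derivative_mult has_derivative_base_function \<Gamma>_diff
      has_derivative_fibre_coordinate assms)

lemma frechet_derivative_\<Gamma>_zero: "x \<in> X \<Longrightarrow> frechet_derivative (\<Gamma> \<rho> \<mu> \<nu>) (at x) 0 = 0"
  using \<Gamma>_diff linear_frechet_derivative linear_0 by blast

lemma dy_N: "fst z \<in> X \<Longrightarrow> dy \<kappa> (N \<rho> \<mu>) z = \<Gamma> \<rho> \<mu> \<kappa> (fst z)"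
  by (simp add: dy_eqI[OF N_has_derivative] frechet_derivative_\<Gamma>_zero)

lemma dx_N: "fst z \<in> X \<Longrightarrow> dx \<kappa> (N \<rho> \<mu>) z = (\<Sum>\<nu>\<in>UNIV. pd \<kappa> (\<Gamma> \<rho> \<mu> \<nu>) (fst z) * snd z $ \<nu>)"
  by (simp add: dx_eqI[OF N_has_derivative] pd_def)

lemma pd_\<Gamma>_sym: "x \<in> X \<Longrightarrow> pd \<kappa> (\<Gamma> \<rho> \<mu> \<nu>) x = pd \<kappa> (\<Gamma> \<rho> \<nu> \<mu>) x"
  unfolding pd_def using frechet_derivative_cong_open[OF open_X] \<Gamma>_sym by metis

lemma sum_N_sym: "fst z \<in> X \<Longrightarrow> (\<Sum>\<kappa>\<in>UNIV. snd z $ \<kappa> * \<Gamma> \<rho> \<kappa> \<sigma> (fst z)) = N \<rho> \<sigma> z"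
  by (simp add: N_def \<Gamma>_sym[of "fst z" \<rho> \<sigma>] mult.commute)

text \<open>The spray is a quadratic form in \<open>y\<close> with coefficients
  \<open>\<Gamma>\<close> symmetric in the lower indices, so the two factors \<open>y\<close>
  contribute equally to a fibre derivative; hence the 2. The derivative \<open>D\<close> stays
  abstract because only its values on fibre directions matter.\<close>

lemma spray_N_has_derivative:
  assumes "fst z \<in> X"
  obtains D where "((\<lambda>z. \<Sum>\<kappa>\<in>UNIV. N \<rho> \<kappa> z * snd z $ \<kappa>) has_derivative D) (at z)"
    "\<And>\<mu>. D (0, axis \<mu> 1) = 2 * N \<rho> \<mu> z"
proof
  show "((\<lambda>z. \<Sum>\<kappa>\<in>UNIV. N \<rho> \<kappa> z * snd z $ \<kappa>) has_derivative
      (\<lambda>h. \<Sum>\<kappa>\<in>UNIV. N \<rho> \<kappa> z * snd h $ \<kappa> + (\<Sum>\<nu>\<in>UNIV. \<Gamma> \<rho> \<kappa> \<nu> (fst z) * snd h $ \<nu>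
    + frechet_derivative (\<Gamma> \<rho> \<kappa> \<nu>) (at (fst z)) (fst h) * snd z $ \<nu>) * snd z $ \<kappa>)) (at z)"
    by (intro has_derivative_sum has_derivative_mult N_has_derivative
        has_derivative_fibre_coordinate assms)
  show "(\<Sum>\<kappa>\<in>UNIV. N \<rho> \<kappa> z * snd (0, axis \<mu> 1) $ \<kappa>
      + (\<Sum>\<nu>\<in>UNIV. \<Gamma> \<rho> \<kappa> \<nu> (fst z) * snd (0, axis \<mu> 1) $ \<nu>
    + frechet_derivative (\<Gamma> \<rho> \<kappa> \<nu>) (at (fst z)) (fst (0, axis \<mu> 1)) * snd z $ \<nu>) * snd z $ \<kappa>)
    = 2 * N \<rho> \<mu> z" for \<mu>
    using assms sum_N_sym[OF assms, of \<rho> \<mu>]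
    by (simp add: frechet_derivative_\<Gamma>_zero sum.distrib mult.commute)
qed

text \<open>Fibre derivatives of \<open>N\<close> return \<open>\<Gamma>\<close>, and base
  derivatives stay linear in \<open>y\<close>. The curvature of \<open>N\<close> is therefore the
  curvature of \<open>\<Gamma>\<close> contracted with one \<open>y\<close>, and its trace
  contracted with the second \<open>y\<close> is the Ricci tensor on \<open>(y, y)\<close>. Symmetry
  of \<open>\<Gamma>\<close> puts the indices in the order used by
  \<open>ricci_comp\<close>.\<close>

lemma trace_curvature_N:
  assumes "fst z \<in> X"
  shows "(\<Sum>\<mu>\<in>UNIV. \<Sum>\<nu>\<in>UNIV.
      ((dx \<mu> (N \<mu> \<nu>) z - (\<Sum>\<sigma>\<in>UNIV. N \<sigma> \<mu> z * dy \<sigma> (N \<mu> \<nu>) z))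
     - (dx \<nu> (N \<mu> \<mu>) z - (\<Sum>\<sigma>\<in>UNIV. N \<sigma> \<nu> z * dy \<sigma> (N \<mu> \<mu>) z))) * snd z $ \<nu>)
    = (\<Sum>\<nu>\<in>UNIV. \<Sum>\<kappa>\<in>UNIV. snd z $ \<nu> * snd z $ \<kappa> * (\<Sum>\<rho>\<in>UNIV.
        pd \<rho> (\<Gamma> \<rho> \<kappa> \<nu>) (fst z) - pd \<nu> (\<Gamma> \<rho> \<kappa> \<rho>) (fst z) +
        (\<Sum>\<sigma>\<in>UNIV. \<Gamma> \<rho> \<rho> \<sigma> (fst z) * \<Gamma> \<sigma> \<kappa> \<nu> (fst z) - \<Gamma> \<rho> \<nu> \<sigma> (fst z) * \<Gamma> \<sigma> \<kappa> \<rho> (fst z))))"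
proof -
  let ?x = "fst z" and ?y = "\<lambda>\<kappa>. snd z $ \<kappa>"
  let ?R = "\<lambda>\<mu> \<nu> \<kappa>. pd \<mu> (\<Gamma> \<mu> \<kappa> \<nu>) ?x - pd \<nu> (\<Gamma> \<mu> \<kappa> \<mu>) ?x +
        (\<Sum>\<sigma>\<in>UNIV. \<Gamma> \<mu> \<mu> \<sigma> ?x * \<Gamma> \<sigma> \<kappa> \<nu> ?x - \<Gamma> \<mu> \<nu> \<sigma> ?x * \<Gamma> \<sigma> \<kappa> \<mu> ?x)"
  have NN: "(\<Sum>\<sigma>\<in>UNIV. N \<sigma> \<alpha> z * dy \<sigma> (N \<mu> \<beta>) z)
      = (\<Sum>\<kappa>\<in>UNIV. ?y \<kappa> * (\<Sum>\<sigma>\<in>UNIV. \<Gamma> \<mu> \<beta> \<sigma> ?x * \<Gamma> \<sigma> \<kappa> \<alpha> ?x))" for \<alpha> \<beta> \<mu>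
  proof -
    have "(\<Sum>\<sigma>\<in>UNIV. N \<sigma> \<alpha> z * dy \<sigma> (N \<mu> \<beta>) z)
        = (\<Sum>\<sigma>\<in>UNIV. \<Sum>\<kappa>\<in>UNIV. ?y \<kappa> * (\<Gamma> \<mu> \<beta> \<sigma> ?x * \<Gamma> \<sigma> \<kappa> \<alpha> ?x))"
      by (simp add: dy_N[OF assms] sum_N_sym[OF assms, symmetric] sum_distrib_left sum_distrib_right mult_ac)
    also have "\<dots> = (\<Sum>\<kappa>\<in>UNIV. \<Sum>\<sigma>\<in>UNIV. ?y \<kappa> * (\<Gamma> \<mu> \<beta> \<sigma> ?x * \<Gamma> \<sigma> \<kappa> \<alpha> ?x))"
      by (rule sum.swap)
    finally show ?thesis by (simp add: sum_distrib_left)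
  qed
  have DN: "dx \<alpha> (N \<mu> \<beta>) z = (\<Sum>\<kappa>\<in>UNIV. ?y \<kappa> * pd \<alpha> (\<Gamma> \<mu> \<kappa> \<beta>) ?x)" for \<alpha> \<beta> \<mu>
    using pd_\<Gamma>_sym[OF assms, of \<alpha> \<mu> \<beta>] by (simp add: dx_N[OF assms] mult.commute)
  have "(dx \<mu> (N \<mu> \<nu>) z - (\<Sum>\<sigma>\<in>UNIV. N \<sigma> \<mu> z * dy \<sigma> (N \<mu> \<nu>) z))
     - (dx \<nu> (N \<mu> \<mu>) z - (\<Sum>\<sigma>\<in>UNIV. N \<sigma> \<nu> z * dy \<sigma> (N \<mu> \<mu>) z))
     = (\<Sum>\<kappa>\<in>UNIV. ?y \<kappa> * ?R \<mu> \<nu> \<kappa>)" for \<mu> \<nu>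
    unfolding NN DN by (simp add: sum_subtractf sum.distrib algebra_simps)
  then have "(\<Sum>\<mu>\<in>UNIV. \<Sum>\<nu>\<in>UNIV.
      ((dx \<mu> (N \<mu> \<nu>) z - (\<Sum>\<sigma>\<in>UNIV. N \<sigma> \<mu> z * dy \<sigma> (N \<mu> \<nu>) z))
     - (dx \<nu> (N \<mu> \<mu>) z - (\<Sum>\<sigma>\<in>UNIV. N \<sigma> \<nu> z * dy \<sigma> (N \<mu> \<mu>) z))) * ?y \<nu>)
     = (\<Sum>\<mu>\<in>UNIV. \<Sum>\<nu>\<in>UNIV. \<Sum>\<kappa>\<in>UNIV. ?y \<nu> * ?y \<kappa> * ?R \<mu> \<nu> \<kappa>)"
    by (simp only: sum_distrib_right) (simp add: mult_ac)
  also have "\<dots> = (\<Sum>\<nu>\<in>UNIV. \<Sum>\<kappa>\<in>UNIV. \<Sum>\<mu>\<in>UNIV. ?y \<nu> * ?y \<kappa> * ?R \<mu> \<nu> \<kappa>)"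
    by (subst sum.swap, subst (2) sum.swap) (rule refl)
  finally show ?thesis by (simp only: sum_distrib_left)
qed

end

section \<open>The canonical connection and curvature of a horizontally constant Lagrangian\<close>

text \<open>\<open>L_horizontal\<close> says that \<open>L\<close> has zero horizontal derivative
  with respect to \<open>N\<close>, not with respect to its own canonical connection; that the two
  coincide is the conclusion to be drawn.\<close>

locale horizontally_constant_lagrangian = symmetric_connection X \<Gamma>
  for X :: "(real ^ 'n::finite) set" and \<Gamma> +
  fixes U :: "'n coords set" and L :: "'n coords \<Rightarrow> real"
  assumes open_U: "open U" and fst_U: "z \<in> U \<Longrightarrow> fst z \<in> X"
    and L_smooth: "smooth_on U L"
    and regular: "z \<in> U \<Longrightarrow> invertible (\<chi> \<mu> \<nu>. fund_tensor L \<mu> \<nu> z)"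
    and L_horizontal: "z \<in> U \<Longrightarrow> dx \<mu> L z = (\<Sum>\<rho>\<in>UNIV. N \<rho> \<mu> z * dy \<rho> L z)"
begin

text \<open>This is the fibre derivative of \<open>L_horizontal\<close>, with the mixed derivative
  on the left exchanged. The 2 compensates the factor 1/2 in \<open>fund_tensor\<close>.\<close>

lemma dx_dy_L:
  assumes "z \<in> U"
  shows "dx \<kappa> (dy \<sigma> L) z
    = (\<Sum>\<rho>\<in>UNIV. \<Gamma> \<rho> \<kappa> \<sigma> (fst z) * dy \<rho> L z + 2 * (N \<rho> \<kappa> z * fund_tensor L \<sigma> \<rho> z))"
proof -
  have D: "(dy \<rho> L has_derivative frechet_derivative (dy \<rho> L) (at z)) (at z)" for \<rho>
    using smooth_on_differentiable[OF smooth_on_derivative[OF L_smooth] assms]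
    by (simp add: dy_def frechet_derivative_works)
  have "dx \<kappa> (dy \<sigma> L) z = dy \<sigma> (dx \<kappa> L) z"
    unfolding dx_def dy_def by (rule smooth_on_second_derivative_symmetric[OF open_U L_smooth assms])
  also have "\<dots> = dy \<sigma> (\<lambda>z. \<Sum>\<rho>\<in>UNIV. N \<rho> \<kappa> z * dy \<rho> L z) z"
    by (rule dy_cong_open[OF open_U assms L_horizontal])
  also have "\<dots> = (\<Sum>\<rho>\<in>UNIV. N \<rho> \<kappa> z * dy \<sigma> (dy \<rho> L) z + \<Gamma> \<rho> \<kappa> \<sigma> (fst z) * dy \<rho> L z)"
    by (subst dy_eqI[OF has_derivative_sum[OF has_derivative_mult[OF N_has_derivative[OF fst_U[OF assms]] D]]])
      (simp add: dy_def frechet_derivative_\<Gamma>_zero[OF fst_U[OF assms]])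
  finally show ?thesis by (simp add: fund_tensor_def algebra_simps)
qed

text \<open>In \<open>dx_dy_L\<close> contracted with \<open>y\<close>, the term in
  \<open>\<Gamma>\<close> becomes \<open>N\<close> applied to the fibre gradient of
  \<open>L\<close>, which is \<open>dx \<sigma> L\<close> by horizontal constancy and cancels. What
  remains is twice the fundamental tensor applied to the spray of \<open>N\<close>, and the inverse
  tensor removes the former.\<close>

lemma geodesic_coefficients:
  assumes "z \<in> U"
  shows "(\<Sum>\<sigma>\<in>UNIV. fund_inv L \<rho> \<sigma> z * ((\<Sum>\<kappa>\<in>UNIV. snd z $ \<kappa> * dx \<kappa> (dy \<sigma> L) z) - dx \<sigma> L z))
    = 2 * (\<Sum>\<kappa>\<in>UNIV. N \<rho> \<kappa> z * snd z $ \<kappa>)"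
proof -
  let ?Q = "\<lambda>\<rho>. \<Sum>\<kappa>\<in>UNIV. N \<rho> \<kappa> z * snd z $ \<kappa>"
  have "(\<Sum>\<kappa>\<in>UNIV. snd z $ \<kappa> * dx \<kappa> (dy \<sigma> L) z)
      = (\<Sum>\<rho>\<in>UNIV. N \<rho> \<sigma> z * dy \<rho> L z) + 2 * (\<Sum>\<rho>\<in>UNIV. fund_tensor L \<sigma> \<rho> z * ?Q \<rho>)" for \<sigma>
  proof -
    have "(\<Sum>\<kappa>\<in>UNIV. snd z $ \<kappa> * dx \<kappa> (dy \<sigma> L) z)
      = (\<Sum>\<kappa>\<in>UNIV. \<Sum>\<rho>\<in>UNIV. snd z $ \<kappa> * \<Gamma> \<rho> \<kappa> \<sigma> (fst z) * dy \<rho> L z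
          + 2 * (fund_tensor L \<sigma> \<rho> z * (N \<rho> \<kappa> z * snd z $ \<kappa>)))"
      by (simp add: dx_dy_L[OF assms] sum_distrib_left algebra_simps)
    also have "\<dots> = (\<Sum>\<rho>\<in>UNIV. \<Sum>\<kappa>\<in>UNIV. snd z $ \<kappa> * \<Gamma> \<rho> \<kappa> \<sigma> (fst z) * dy \<rho> L z
          + 2 * (fund_tensor L \<sigma> \<rho> z * (N \<rho> \<kappa> z * snd z $ \<kappa>)))"
      by (rule sum.swap)
    also have "\<dots> = (\<Sum>\<rho>\<in>UNIV. N \<rho> \<sigma> z * dy \<rho> L z) + 2 * (\<Sum>\<rho>\<in>UNIV. fund_tensor L \<sigma> \<rho> z * ?Q \<rho>)"
      by (simp only: sum.distrib flip: sum_distrib_left sum_distrib_right sum_N_sym[OF fst_U[OF assms]])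
    finally show ?thesis .
  qed
  then have "(\<Sum>\<sigma>\<in>UNIV. fund_inv L \<rho> \<sigma> z * ((\<Sum>\<kappa>\<in>UNIV. snd z $ \<kappa> * dx \<kappa> (dy \<sigma> L) z) - dx \<sigma> L z))
      = (\<Sum>\<sigma>\<in>UNIV. fund_inv L \<rho> \<sigma> z * (2 * (\<Sum>\<tau>\<in>UNIV. fund_tensor L \<sigma> \<tau> z * ?Q \<tau>)))"
    by (simp add: L_horizontal[OF assms])
  also have "\<dots> = (\<Sum>\<sigma>\<in>UNIV. \<Sum>\<tau>\<in>UNIV. 2 * (fund_inv L \<rho> \<sigma> z * fund_tensor L \<sigma> \<tau> z * ?Q \<tau>))"
    by (simp add: sum_distrib_left mult_ac)
  also have "\<dots> = (\<Sum>\<tau>\<in>UNIV. \<Sum>\<sigma>\<in>UNIV. 2 * (fund_inv L \<rho> \<sigma> z * fund_tensor L \<sigma> \<tau> z * ?Q \<tau>))"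
    by (rule sum.swap)
  also have "\<dots> = (\<Sum>\<tau>\<in>UNIV. 2 * ((\<Sum>\<sigma>\<in>UNIV. fund_inv L \<rho> \<sigma> z * fund_tensor L \<sigma> \<tau> z) * ?Q \<tau>))"
    by (simp only: flip: sum_distrib_left sum_distrib_right)
  also have "\<dots> = 2 * ?Q \<rho>"
    by (simp add: fund_inv_def sum_inverse_comp(1)[where g = "fund_tensor L", OF regular[OF assms]] if_distribR if_distrib cong: if_cong)
  finally show ?thesis .
qed

text \<open>The bracket in the definition is twice the spray of \<open>N\<close> on the open set
  \<open>U\<close>, and the fibre derivative of that spray is \<open>2 * N \<rho> \<mu> z\<close>;
  the prefactor 1/4 cancels both factors 2.\<close>

lemma nonlinear_conn_eq:
  assumes "z \<in> U"
  shows "nonlinear_conn L \<rho> \<mu> z = N \<rho> \<mu> z"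
proof -
  obtain D where D: "((\<lambda>z. \<Sum>\<kappa>\<in>UNIV. N \<rho> \<kappa> z * snd z $ \<kappa>) has_derivative D) (at z)"
    "\<And>\<mu>. D (0, axis \<mu> 1) = 2 * N \<rho> \<mu> z"
    using spray_N_has_derivative[OF fst_U[OF assms], of \<rho>] by blast
  have "nonlinear_conn L \<rho> \<mu> z = 1/4 * dy \<mu> (\<lambda>z. 2 * (\<Sum>\<kappa>\<in>UNIV. N \<rho> \<kappa> z * snd z $ \<kappa>)) z"
    unfolding nonlinear_conn_def
    by (rule arg_cong[where f = "\<lambda>r. 1/4 * r"]) (rule dy_cong_open[OF open_U assms geodesic_coefficients])
  also have "\<dots> = N \<rho> \<mu> z"
    by (simp add: dy_eqI[OF has_derivative_mult_right[OF D(1)]] D(2))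
  finally show ?thesis .
qed

lemma finsler_ric_eq:
  assumes "z \<in> U"
  shows "finsler_ric L z = (\<Sum>\<nu>\<in>UNIV. \<Sum>\<kappa>\<in>UNIV. snd z $ \<nu> * snd z $ \<kappa> * (\<Sum>\<rho>\<in>UNIV.
        pd \<rho> (\<Gamma> \<rho> \<kappa> \<nu>) (fst z) - pd \<nu> (\<Gamma> \<rho> \<kappa> \<rho>) (fst z) +
        (\<Sum>\<sigma>\<in>UNIV. \<Gamma> \<rho> \<rho> \<sigma> (fst z) * \<Gamma> \<sigma> \<kappa> \<nu> (fst z) - \<Gamma> \<rho> \<nu> \<sigma> (fst z) * \<Gamma> \<sigma> \<kappa> \<rho> (fst z))))"
proof -
  have "dx \<kappa> (nonlinear_conn L \<rho> \<mu>) z = dx \<kappa> (N \<rho> \<mu>) z"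
    "dy \<kappa> (nonlinear_conn L \<rho> \<mu>) z = dy \<kappa> (N \<rho> \<mu>) z" for \<kappa> \<rho> \<mu>
    using dx_cong_open[OF open_U assms nonlinear_conn_eq] dy_cong_open[OF open_U assms nonlinear_conn_eq]
    by auto
  then show ?thesis
    unfolding finsler_ric_def nl_curvature_def hor_def
    by (simp only: nonlinear_conn_eq[OF assms] trace_curvature_N[OF fst_U[OF assms]])
qed

text \<open>On \<open>U\<close> the spray is quadratic in \<open>y\<close>, so its third fibre
  derivatives vanish. The facts \<open>1\<close>, \<open>2\<close> and \<open>3\<close> are its
  successive derivatives, each valid on an open set so that it can be differentiated again.\<close>

lemma landsberg_zero:
  assumes "z \<in> U"
  shows "landsberg L \<mu> \<nu> \<rho> z = 0"
proof -
  have "dy \<rho> (spray L \<sigma>) z = 2 * N \<sigma> \<rho> z" if z: "z \<in> U" for z \<sigma>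
  proof -
    obtain D where D: "((\<lambda>z. \<Sum>\<kappa>\<in>UNIV. N \<sigma> \<kappa> z * snd z $ \<kappa>) has_derivative D) (at z)"
      "\<And>\<mu>. D (0, axis \<mu> 1) = 2 * N \<sigma> \<mu> z"
      using spray_N_has_derivative[OF fst_U[OF z], of \<sigma>] by blast
    have "dy \<rho> (spray L \<sigma>) z = dy \<rho> (\<lambda>z. \<Sum>\<kappa>\<in>UNIV. N \<sigma> \<kappa> z * snd z $ \<kappa>) z"
      by (rule dy_cong_open[OF open_U z]) (simp add: spray_def nonlinear_conn_eq)
    then show ?thesis by (simp add: dy_eqI[OF D(1)] D(2))
  qed note 1 = this
  have 2: "dy \<nu> (dy \<rho> (spray L \<sigma>)) z = 2 * \<Gamma> \<sigma> \<rho> \<nu> (fst z)" if z: "z \<in> U" for z \<sigma>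
    by (simp add: dy_cong_open[OF open_U z 1] frechet_derivative_\<Gamma>_zero[OF fst_U[OF z]]
        dy_eqI[OF has_derivative_mult_right[OF N_has_derivative[OF fst_U[OF z]]]])
  have 3: "dy \<mu> (dy \<nu> (dy \<rho> (spray L \<sigma>))) z = 0" for \<sigma>
    using dy_cong_open[OF open_U assms 2, where \<mu> = \<mu>]
      dy_eqI[OF has_derivative_mult_right[OF has_derivative_base_function[OF \<Gamma>_diff[OF fst_U[OF assms]]]]]
    by (simp add: frechet_derivative_\<Gamma>_zero[OF fst_U[OF assms]])
  show ?thesis by (simp add: landsberg_def 3)
qed

lemma mean_landsberg_zero: "z \<in> U \<Longrightarrow> mean_landsberg L \<mu> z = 0"
  by (simp add: mean_landsberg_def landsberg_zero)

lemma hor_mean_landsberg_zero: "z \<in> U \<Longrightarrow> hor L \<mu> (mean_landsberg L \<nu>) z = 0"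
  using dx_zero_open[OF open_U _ mean_landsberg_zero] dy_const_open[OF open_U _ mean_landsberg_zero]
  by (simp add: hor_def)

end

text \<open>The assumption is the expression in \<open>ricci_comp\<close>, written for arbitrary
  coefficients \<open>\<Gamma>\<close> as it comes out of \<open>finsler_ric_eq\<close>.\<close>

locale ricci_flat_lagrangian = horizontally_constant_lagrangian +
  assumes ricci_zero: "x \<in> X \<Longrightarrow> (\<Sum>\<rho>\<in>UNIV.
        pd \<rho> (\<Gamma> \<rho> \<mu> \<nu>) x - pd \<nu> (\<Gamma> \<rho> \<mu> \<rho>) x +
        (\<Sum>\<sigma>\<in>UNIV. \<Gamma> \<rho> \<rho> \<sigma> x * \<Gamma> \<sigma> \<mu> \<nu> x - \<Gamma> \<rho> \<nu> \<sigma> x * \<Gamma> \<sigma> \<mu> \<rho> x)) = 0"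
begin

lemma finsler_ric_zero: "z \<in> U \<Longrightarrow> finsler_ric L z = 0"
  by (simp add: finsler_ric_eq ricci_zero fst_U)

lemma finsler_ricci_zero: "z \<in> U \<Longrightarrow> finsler_ricci L \<mu> \<nu> z = 0"
  using dy_const_open[OF open_U _ dy_const_open[OF open_U _ finsler_ric_zero]]
  by (simp add: finsler_ricci_def)

end

text \<open>Every term contains the Ricci scalar, the Ricci tensor, the mean Landsberg tensor or a
  derivative of the latter, and all of these vanish on \<open>U\<close>. The lemma stands outside
  the locale because \<open>field_equation_lhs\<close> fixes the dimension to 4.\<close>

lemma field_equation_of_ricci_flat_lagrangian:
  assumes "ricci_flat_lagrangian X \<Gamma> U L" "z \<in> U"
  shows "field_equation_lhs L z = 0"
proof -
  interpret ricci_flat_lagrangian X \<Gamma> U L by fact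
  have "dyn_mean_landsberg L \<nu> z = 0" if "z \<in> U" for z \<nu>
    using that by (simp add: dyn_mean_landsberg_def hor_mean_landsberg_zero mean_landsberg_zero)
  then have "dy \<mu> (dyn_mean_landsberg L \<nu>) z = 0" for \<mu> \<nu>
    using dy_const_open[OF open_U assms(2)] by blast
  then show ?thesis
    using assms(2)
    by (simp add: field_equation_lhs_def finsler_ric_zero finsler_ricci_zero mean_landsberg_zero
        chern_mean_landsberg_def hor_mean_landsberg_zero)
qed

section \<open>Horizontal constancy for the Levi-Civita connection\<close>

locale smooth_metric =
  fixes X :: "(real ^ 'n::finite) set" and h :: "'n \<Rightarrow> 'n \<Rightarrow> real ^ 'n \<Rightarrow> real"
  assumes open_X: "open X"
    and h_smooth: "smooth_on X (h \<mu> \<nu>)"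
    and h_sym: "x \<in> X \<Longrightarrow> h \<mu> \<nu> x = h \<nu> \<mu> x"
    and h_inv: "x \<in> X \<Longrightarrow> invertible (\<chi> \<mu> \<nu>. h \<mu> \<nu> x)"
begin

lemma pd_h_sym: "x \<in> X \<Longrightarrow> pd \<kappa> (h \<mu> \<nu>) x = pd \<kappa> (h \<nu> \<mu>) x"
  unfolding pd_def using frechet_derivative_cong_open[OF open_X] h_sym by metis

lemma pd_h_differentiable: "x \<in> X \<Longrightarrow> pd \<kappa> (h \<mu> \<nu>) differentiable (at x)"
  unfolding pd_def by (rule smooth_on_differentiable[OF smooth_on_derivative[OF h_smooth]])

sublocale symmetric_connection X "christoffel h"
proof
  show "open X" by (rule open_X)
next
  fix x \<rho> \<mu> \<nu> assume "x \<in> X"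
  then show "christoffel h \<rho> \<mu> \<nu> x = christoffel h \<rho> \<nu> \<mu> x"
    using pd_h_sym[of x] unfolding christoffel_def by (metis (no_types, opaque_lifting) add.commute)
next
  fix x \<rho> \<mu> \<nu> assume x: "x \<in> X"
  then have "inverse_comp h \<alpha> \<beta> differentiable (at x)" for \<alpha> \<beta>
    by (intro differentiable_inverse_comp[OF open_X] smooth_on_differentiable[OF h_smooth] h_inv)
  then have "(\<lambda>x. inverse_comp h \<rho> \<sigma> x *
      (pd \<mu> (h \<sigma> \<nu>) x + pd \<nu> (h \<mu> \<sigma>) x - pd \<sigma> (h \<mu> \<nu>) x)) differentiable (at x)" for \<sigma>
    using x by (intro differentiable_mult differentiable_diff differentiable_add pd_h_differentiable)
  then show "christoffel h \<rho> \<mu> \<nu> differentiable (at x)"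
    unfolding christoffel_def by (intro differentiable_mult differentiable_sum) auto
qed

text \<open>The metric cancels the inverse metric in \<open>christoffel\<close>, which leaves the
  Christoffel symbols of the first kind.\<close>

lemma christoffel_lower:
  assumes "x \<in> X"
  shows "(\<Sum>\<rho>\<in>UNIV. h \<tau> \<rho> x * christoffel h \<rho> \<mu> \<nu> x)
    = 1/2 * (pd \<mu> (h \<tau> \<nu>) x + pd \<nu> (h \<mu> \<tau>) x - pd \<tau> (h \<mu> \<nu>) x)"
proof -
  let ?K = "\<lambda>\<sigma>. pd \<mu> (h \<sigma> \<nu>) x + pd \<nu> (h \<mu> \<sigma>) x - pd \<sigma> (h \<mu> \<nu>) x"
  have "(\<Sum>\<rho>\<in>UNIV. h \<tau> \<rho> x * christoffel h \<rho> \<mu> \<nu> x)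
      = (\<Sum>\<rho>\<in>UNIV. \<Sum>\<sigma>\<in>UNIV. 1/2 * (h \<tau> \<rho> x * inverse_comp h \<rho> \<sigma> x * ?K \<sigma>))"
    unfolding christoffel_def sum_distrib_left by (simp only: mult_ac)
  also have "\<dots> = (\<Sum>\<sigma>\<in>UNIV. \<Sum>\<rho>\<in>UNIV. 1/2 * (h \<tau> \<rho> x * inverse_comp h \<rho> \<sigma> x * ?K \<sigma>))"
    by (rule sum.swap)
  also have "\<dots> = (\<Sum>\<sigma>\<in>UNIV. 1/2 * ((\<Sum>\<rho>\<in>UNIV. h \<tau> \<rho> x * inverse_comp h \<rho> \<sigma> x) * ?K \<sigma>))"
    by (simp only: flip: sum_distrib_left sum_distrib_right)
  also have "\<dots> = (\<Sum>\<sigma>\<in>UNIV. if \<tau> = \<sigma> then 1/2 * ?K \<sigma> else 0)"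
    by (rule sum.cong) (simp_all add: sum_inverse_comp(2)[where g = h, OF h_inv[OF assms]])
  finally show ?thesis by simp
qed

text \<open>In the sum of the two symbols of the first kind, the derivatives in directions other
  than \<open>\<kappa>\<close> cancel in pairs by the symmetry of \<open>h\<close>.\<close>

lemma metric_compatible:
  assumes "x \<in> X"
  shows "pd \<kappa> (h \<mu> \<nu>) x
    = (\<Sum>\<rho>\<in>UNIV. h \<nu> \<rho> x * christoffel h \<rho> \<kappa> \<mu> x) + (\<Sum>\<rho>\<in>UNIV. h \<mu> \<rho> x * christoffel h \<rho> \<kappa> \<nu> x)"
  unfolding christoffel_lower[OF assms]
  using pd_h_sym[OF assms] by (simp add: field_simps)

text \<open>The horizontal lift of \<open>\<partial>\<^sub>\<kappa>\<close>.\<close>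

definition hvec :: "'n \<Rightarrow> 'n coords \<Rightarrow> 'n coords" where
  "hvec \<kappa> z = (axis \<kappa> 1, - (\<chi> \<rho>. N \<rho> \<kappa> z))"

text \<open>Expanding \<open>hvec \<kappa> z\<close> in the coordinate basis, linearity of
  \<open>D\<close> turns its vanishing on the horizontal lift into the form demanded by
  \<open>L_horizontal\<close>.\<close>

lemma hvec_derivative:
  assumes "(f has_derivative D) (at z)" "D (hvec \<kappa> z) = 0"
  shows "dx \<kappa> f z = (\<Sum>\<rho>\<in>UNIV. N \<rho> \<kappa> z * dy \<rho> f z)"
proof -
  have lin: "linear D" using assms(1) has_derivative_linear by blast
  have "(\<chi> \<rho>. N \<rho> \<kappa> z) = (\<Sum>\<rho>\<in>UNIV. N \<rho> \<kappa> z *\<^sub>R axis \<rho> 1)"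
    using basis_expansion[of "\<chi> \<rho>. N \<rho> \<kappa> z"] by (simp add: scalar_mult_eq_scaleR)
  then have "hvec \<kappa> z = (axis \<kappa> 1, 0) - (\<Sum>\<rho>\<in>UNIV. N \<rho> \<kappa> z *\<^sub>R (0, axis \<rho> 1))"
    by (simp add: hvec_def prod_eq_iff fst_sum snd_sum)
  then have "D (hvec \<kappa> z) = D (axis \<kappa> 1, 0) - (\<Sum>\<rho>\<in>UNIV. N \<rho> \<kappa> z * D (0, axis \<rho> 1))"
    by (simp add: linear_diff[OF lin] linear_sum[OF lin] linear_cmul[OF lin] del: scaleR_Pair)
  then show ?thesis
    using assms(2) by (simp add: dx_eqI[OF assms(1)] dy_eqI[OF assms(1)])
qed

text \<open>Along the lift, the base part of the derivative is \<open>?T + ?T\<close> by metric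
  compatibility, while each of the two factors \<open>y\<close> contributes \<open>- ?T\<close>,
  because the fibre component of \<open>hvec\<close> is minus \<open>N\<close>.\<close>

lemma quadratic_form_horizontal:
  assumes "fst z \<in> X"
  obtains D where
    "((\<lambda>z. \<Sum>\<mu>\<in>UNIV. \<Sum>\<nu>\<in>UNIV. h \<mu> \<nu> (fst z) * (snd z $ \<mu> * snd z $ \<nu>)) has_derivative D) (at z)"
    "\<And>\<kappa>. D (hvec \<kappa> z) = 0"
proof
  let ?x = "fst z" and ?y = "\<lambda>\<mu>. snd z $ \<mu>"
  let ?D = "\<lambda>k. \<Sum>\<mu>\<in>UNIV. \<Sum>\<nu>\<in>UNIV. h \<mu> \<nu> ?x * (?y \<mu> * snd k $ \<nu> + snd k $ \<mu> * ?y \<nu>)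
        + frechet_derivative (h \<mu> \<nu>) (at ?x) (fst k) * (?y \<mu> * ?y \<nu>)"
  show "((\<lambda>z. \<Sum>\<mu>\<in>UNIV. \<Sum>\<nu>\<in>UNIV. h \<mu> \<nu> (fst z) * (snd z $ \<mu> * snd z $ \<nu>))
    has_derivative ?D) (at z)"
    by (intro has_derivative_sum has_derivative_mult has_derivative_base_function
        smooth_on_differentiable[OF h_smooth] has_derivative_fibre_coordinate assms)
  show "?D (hvec \<kappa> z) = 0" for \<kappa>
  proof -
    let ?G = "\<lambda>\<rho> \<mu>. christoffel h \<rho> \<kappa> \<mu> ?x"
    let ?T = "\<Sum>\<mu>\<in>UNIV. \<Sum>\<nu>\<in>UNIV. \<Sum>\<rho>\<in>UNIV. h \<mu> \<rho> ?x * ?G \<rho> \<nu> * ?y \<mu> * ?y \<nu>"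
    have T: "(\<Sum>\<mu>\<in>UNIV. \<Sum>\<nu>\<in>UNIV. h \<mu> \<nu> ?x * (?y \<mu> * N \<nu> \<kappa> z)) = ?T"
    proof -
      have "(\<Sum>\<mu>\<in>UNIV. \<Sum>\<nu>\<in>UNIV. h \<mu> \<nu> ?x * (?y \<mu> * N \<nu> \<kappa> z))
        = (\<Sum>\<mu>\<in>UNIV. \<Sum>\<rho>\<in>UNIV. \<Sum>\<nu>\<in>UNIV. h \<mu> \<rho> ?x * ?G \<rho> \<nu> * ?y \<mu> * ?y \<nu>)"
        by (simp add: N_def sum_distrib_left mult_ac)
      also have "\<dots> = ?T" by (intro sum.cong refl sum.swap)
      finally show ?thesis .
    qed
    have T': "(\<Sum>\<mu>\<in>UNIV. \<Sum>\<nu>\<in>UNIV. h \<mu> \<nu> ?x * (N \<mu> \<kappa> z * ?y \<nu>)) = ?T"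
    proof -
      have "(\<Sum>\<mu>\<in>UNIV. \<Sum>\<nu>\<in>UNIV. h \<mu> \<nu> ?x * (N \<mu> \<kappa> z * ?y \<nu>))
        = (\<Sum>\<nu>\<in>UNIV. \<Sum>\<mu>\<in>UNIV. h \<nu> \<mu> ?x * (?y \<nu> * N \<mu> \<kappa> z))"
        by (subst sum.swap) (simp add: h_sym[OF assms] mult_ac)
      then show ?thesis by (simp add: T)
    qed
    have "(\<Sum>\<mu>\<in>UNIV. \<Sum>\<nu>\<in>UNIV. pd \<kappa> (h \<mu> \<nu>) ?x * (?y \<mu> * ?y \<nu>))
      = (\<Sum>\<mu>\<in>UNIV. \<Sum>\<nu>\<in>UNIV. \<Sum>\<rho>\<in>UNIV. h \<nu> \<rho> ?x * ?G \<rho> \<mu> * ?y \<nu> * ?y \<mu>) + ?T"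
      by (simp add: metric_compatible[OF assms] sum_distrib_left sum.distrib distrib_left mult_ac)
    also have "\<dots> = ?T + ?T"
      by (subst sum.swap) (rule refl)
    finally have P: "(\<Sum>\<mu>\<in>UNIV. \<Sum>\<nu>\<in>UNIV. pd \<kappa> (h \<mu> \<nu>) ?x * (?y \<mu> * ?y \<nu>)) = ?T + ?T" .
    have "?D (hvec \<kappa> z) = (\<Sum>\<mu>\<in>UNIV. \<Sum>\<nu>\<in>UNIV. pd \<kappa> (h \<mu> \<nu>) ?x * (?y \<mu> * ?y \<nu>))
      - (\<Sum>\<mu>\<in>UNIV. \<Sum>\<nu>\<in>UNIV. h \<mu> \<nu> ?x * (?y \<mu> * N \<nu> \<kappa> z))
      - (\<Sum>\<mu>\<in>UNIV. \<Sum>\<nu>\<in>UNIV. h \<mu> \<nu> ?x * (N \<mu> \<kappa> z * ?y \<nu>))"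
      by (simp add: hvec_def pd_def flip: sum_subtractf) (simp add: algebra_simps)
    then show ?thesis by (simp add: P T T')
  qed
qed

text \<open>Parallelism turns the base derivative of the coefficients into \<open>b\<close>
  contracted with \<open>N\<close>, which the fibre component of the lift cancels.\<close>

lemma linear_form_horizontal:
  assumes "fst z \<in> X" and b: "\<And>\<nu>. b \<nu> differentiable (at (fst z))"
    and parallel: "\<And>\<mu> \<nu>. pd \<mu> (b \<nu>) (fst z) = (\<Sum>\<rho>\<in>UNIV. christoffel h \<rho> \<mu> \<nu> (fst z) * b \<rho> (fst z))"
  obtains D where
    "((\<lambda>z. \<Sum>\<nu>\<in>UNIV. b \<nu> (fst z) * snd z $ \<nu>) has_derivative D) (at z)" "\<And>\<kappa>. D (hvec \<kappa> z) = 0"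
proof
  let ?x = "fst z" and ?y = "\<lambda>\<mu>. snd z $ \<mu>"
  let ?D = "\<lambda>k. \<Sum>\<nu>\<in>UNIV. b \<nu> ?x * snd k $ \<nu> + frechet_derivative (b \<nu>) (at ?x) (fst k) * ?y \<nu>"
  show "((\<lambda>z. \<Sum>\<nu>\<in>UNIV. b \<nu> (fst z) * snd z $ \<nu>) has_derivative ?D) (at z)"
    by (intro has_derivative_sum has_derivative_mult has_derivative_base_function b
        has_derivative_fibre_coordinate)
  show "?D (hvec \<kappa> z) = 0" for \<kappa>
  proof -
    have "(\<Sum>\<nu>\<in>UNIV. pd \<kappa> (b \<nu>) ?x * ?y \<nu>)
        = (\<Sum>\<nu>\<in>UNIV. \<Sum>\<rho>\<in>UNIV. b \<rho> ?x * (christoffel h \<rho> \<kappa> \<nu> ?x * ?y \<nu>))"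
      by (simp add: parallel sum_distrib_left mult_ac)
    also have "\<dots> = (\<Sum>\<rho>\<in>UNIV. b \<rho> ?x * N \<rho> \<kappa> z)"
      by (subst sum.swap) (simp add: N_def sum_distrib_left)
    finally show ?thesis by (simp add: hvec_def pd_def sum_subtractf)
  qed
qed

end

section \<open>Functions of the quadratic form and the linear form\<close>

text \<open>The function factors through the pair \<open>(A, B)\<close>, so by the chain rule its
  derivative is a linear map \<open>P\<close> applied to \<open>(A' k, B' k)\<close>, and
  \<open>P\<close> sends zero to zero. Since \<open>A z\<close> is nonzero,
  \<open>sqrt \<bar>s\<bar>\<close> is differentiable there for either sign, as an indefinite metric
  requires.\<close>

lemma alpha_beta_derivative_vanishes:
  fixes A B :: "'a::real_normed_vector \<Rightarrow> real"
  assumes A: "(A has_derivative A') (at z)" and B: "(B has_derivative B') (at z)" and "A z \<noteq> 0"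
    and \<phi>: "\<phi> differentiable (at (B z / sqrt \<bar>A z\<bar>))"
  obtains D where "((\<lambda>z. (sqrt \<bar>A z\<bar> * \<phi> (B z / sqrt \<bar>A z\<bar>))\<^sup>2) has_derivative D) (at z)"
    "\<And>k. A' k = 0 \<Longrightarrow> B' k = 0 \<Longrightarrow> D k = 0"
proof -
  let ?q = "\<lambda>s. sqrt \<bar>s\<bar> :: real"
  let ?\<Psi> = "\<lambda>p. (?q (fst p) * \<phi> (snd p / ?q (fst p)))\<^sup>2"
  have "?q differentiable (at (A z))"
  proof (cases "A z > 0")
    case True
    then have "(?q has_real_derivative inverse (sqrt (A z)) / 2) (at (A z))"
      by (intro has_field_derivative_transform_within_open[OF DERIV_real_sqrt[OF True] open_greaterThan[of 0]])
        auto
    then show ?thesis by (auto simp: differentiable_def has_field_derivative_def)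
  next
    case False
    then have neg: "A z < 0" using \<open>A z \<noteq> 0\<close> by simp
    have "((\<lambda>s. sqrt (- s)) has_real_derivative inverse (sqrt (- A z)) / 2 * - 1) (at (A z))"
      by (rule DERIV_chain2[OF DERIV_real_sqrt]) (use neg in \<open>auto intro!: derivative_eq_intros\<close>)
    then have "(?q has_real_derivative inverse (sqrt (- A z)) / 2 * - 1) (at (A z))"
      by (rule has_field_derivative_transform_within_open[OF _ open_lessThan[of 0]]) (use neg in auto)
    then show ?thesis by (auto simp: differentiable_def has_field_derivative_def)
  qed
  then have q: "(\<lambda>p. ?q (fst p)) differentiable (at (A z, B z))"
    using differentiable_compose[of ?q fst "(A z, B z)" UNIV]
    by (simp add: bounded_linear_imp_differentiable bounded_linear_fst)
  then have "(\<lambda>p. snd p / ?q (fst p)) differentiable (at (A z, B z))"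
    using \<open>A z \<noteq> 0\<close>
    by (intro differentiable_divide bounded_linear_imp_differentiable[OF bounded_linear_snd] q) simp
  then have "(\<lambda>p. \<phi> (snd p / ?q (fst p))) differentiable (at (A z, B z))"
    using \<phi> differentiable_compose[of \<phi> "\<lambda>p. snd p / ?q (fst p)" "(A z, B z)" UNIV] by simp
  then have "?\<Psi> differentiable (at (A z, B z))"
    by (intro differentiable_power differentiable_mult q)
  then obtain P where P: "(?\<Psi> has_derivative P) (at (A z, B z))"
    by (auto simp: differentiable_def)
  show ?thesis
  proof
    show "((\<lambda>z. (sqrt \<bar>A z\<bar> * \<phi> (B z / sqrt \<bar>A z\<bar>))\<^sup>2) has_derivative (\<lambda>k. P (A' k, B' k))) (at z)"
      using has_derivative_compose[OF has_derivative_Pair[OF A B] P] by simp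
    show "P (A' k, B' k) = 0" if "A' k = 0" "B' k = 0" for k
      using that linear_0[OF has_derivative_linear[OF P]] by (simp add: zero_prod_def)
  qed
qed

section \<open>Tangent vectors in charts\<close>

locale manifold =
  fixes M :: "'m topology" and \<A> :: "('m, 'n::finite) chart set"
  assumes smooth: "smooth_manifold M \<A>"
begin

lemma chart:
  assumes "c \<in> \<A>"
  shows openin_chart: "openin M (fst c)" and open_chart_range: "open (chart_range c)"
    and homeomorphic_chart: "homeomorphic_map (subtopology M (fst c)) (top_of_set (chart_range c)) (snd c)"
    and inj_chart: "inj_on (snd c) (fst c)"
proof -
  show o: "openin M (fst c)" and "open (chart_range c)"
    and h: "homeomorphic_map (subtopology M (fst c)) (top_of_set (chart_range c)) (snd c)"
    using smooth assms by (auto simp: smooth_manifold_def)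
  have t: "topspace (subtopology M (fst c)) = fst c"
    using openin_subset[OF o] by auto
  show "inj_on (snd c) (fst c)"
    using homeomorphic_imp_injective_map[OF h] unfolding t .
qed

lemma chart_inv_chart: "c \<in> \<A> \<Longrightarrow> p \<in> fst c \<Longrightarrow> chart_inv c (snd c p) = p"
  by (simp add: chart_inv_def inj_chart)

lemma chart_inv_in: "x \<in> chart_range c \<Longrightarrow> chart_inv c x \<in> fst c"
  by (simp add: chart_inv_def chart_range_def inv_into_into)

lemma chart_chart_inv: "x \<in> chart_range c \<Longrightarrow> snd c (chart_inv c x) = x"
  by (simp add: chart_inv_def chart_range_def f_inv_into_f)

lemma open_chart_image:
  assumes "c \<in> \<A>" "openin M W" "W \<subseteq> fst c"
  shows "open (snd c ` W)"
proof -
  have "openin (subtopology M (fst c)) W"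
    using assms(2,3) by (auto simp: openin_subtopology)
  then have "openin (top_of_set (chart_range c)) (snd c ` W)"
    using homeomorphic_imp_open_map[OF homeomorphic_chart[OF assms(1)]] by (simp add: open_map_def)
  then show ?thesis
    using openin_open_eq[OF open_chart_range[OF assms(1)]] by blast
qed

definition J :: "('m, 'n) chart \<Rightarrow> ('m, 'n) chart \<Rightarrow> 'm \<Rightarrow> real ^ 'n \<Rightarrow> real ^ 'n" where
  "J c c' p = frechet_derivative (transition c c') (at (snd c p))"

lemma transition_has_derivative:
  assumes "c \<in> \<A>" "c' \<in> \<A>" "p \<in> fst c" "p \<in> fst c'"
  shows "(transition c c' has_derivative J c c' p) (at (snd c p))"
proof -
  have "smooth_on (snd c ` (fst c \<inter> fst c')) (transition c c')"
    using smooth assms by (auto simp: smooth_manifold_def)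
  then show ?thesis
    using smooth_on_differentiable[of _ "transition c c'" "snd c p"] assms
    by (simp add: J_def frechet_derivative_works)
qed

lemma linear_J:
  "c \<in> \<A> \<Longrightarrow> c' \<in> \<A> \<Longrightarrow> p \<in> fst c \<Longrightarrow> p \<in> fst c' \<Longrightarrow> linear (J c c' p)"
  using transition_has_derivative has_derivative_linear by blast

text \<open>This is the chain rule. The composite of two transition maps is compared with the direct
  one on the image of the triple overlap, an open set around \<open>snd c p\<close>.\<close>

lemma J_compose:
  assumes c: "c \<in> \<A>" "c1 \<in> \<A>" "c2 \<in> \<A>" and p: "p \<in> fst c" "p \<in> fst c1" "p \<in> fst c2"
  shows "J c c2 p = J c1 c2 p \<circ> J c c1 p"
proof -
  let ?W = "fst c \<inter> fst c1 \<inter> fst c2"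
  have "transition c c1 (snd c p) = snd c1 p"
    using c p by (simp add: transition_def chart_inv_chart)
  then have "(transition c1 c2 has_derivative J c1 c2 p) (at (transition c c1 (snd c p)))"
    using transition_has_derivative[of c1 c2 p] c p by simp
  then have "(transition c1 c2 \<circ> transition c c1 has_derivative J c1 c2 p \<circ> J c c1 p) (at (snd c p))"
    by (rule diff_chain_at[OF transition_has_derivative[OF c(1,2) p(1,2)]])
  moreover have "open (snd c ` ?W)"
    using c by (intro open_chart_image openin_Int openin_chart) auto
  moreover have "snd c p \<in> snd c ` ?W" using p by auto
  moreover have "(transition c1 c2 \<circ> transition c c1) x = transition c c2 x" if "x \<in> snd c ` ?W" for x
    using that c by (auto simp: transition_def chart_inv_chart)
  ultimately have "(transition c c2 has_derivative J c1 c2 p \<circ> J c c1 p) (at (snd c p))"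
    by (rule has_derivative_transform_within_open)
  then show ?thesis
    unfolding J_def[of c c2] by (rule frechet_derivative_at[symmetric])
qed

lemma J_same:
  assumes "c \<in> \<A>" "p \<in> fst c"
  shows "J c c p = id"
proof -
  have "(transition c c has_derivative id) (at (snd c p))"
  proof (rule has_derivative_transform_within_open[OF has_derivative_id open_chart_range[OF assms(1)]])
    show "snd c p \<in> chart_range c" using assms by (simp add: chart_range_def)
  qed (simp add: transition_def chart_chart_inv)
  then show ?thesis unfolding J_def by (rule frechet_derivative_at[symmetric])
qed

lemma tvector_of_same: "c \<in> \<A> \<Longrightarrow> p \<in> fst c \<Longrightarrow> tvector_of \<A> c p y c = y"
  using J_same[of c p] by (simp add: tvector_of_def J_def)

text \<open>The compatibility required between any two charts is the cocycle identity
  \<open>J_compose\<close>.\<close>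

lemma tvector_of_in_tangent_space:
  assumes "c \<in> \<A>" "p \<in> fst c"
  shows "tvector_of \<A> c p y \<in> tangent_space \<A> p"
proof -
  have "tvector_of \<A> c p y c2 = frechet_derivative (transition c1 c2) (at (snd c1 p)) (tvector_of \<A> c p y c1)"
    if "c1 \<in> \<A>" "c2 \<in> \<A>" "p \<in> fst c1 \<and> p \<in> fst c2" for c1 c2
    using J_compose[of c c1 c2 p] that assms by (simp add: tvector_of_def flip: J_def)
  moreover have "tvector_of \<A> c p y c' = 0" if "c' \<notin> \<A> \<or> p \<notin> fst c'" for c'
    using that by (auto simp: tvector_of_def)
  ultimately show ?thesis unfolding tangent_space_def by blast
qed

lemma tvector_of_tangent_vector:
  assumes "c \<in> \<A>" "p \<in> fst c" "v \<in> tangent_space \<A> p"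
  shows "tvector_of \<A> c p (v c) = v"
proof
  fix c' show "tvector_of \<A> c p (v c) c' = v c'"
  proof (cases "c' \<in> \<A> \<and> p \<in> fst c'")
    case True
    then have "v c' = frechet_derivative (transition c c') (at (snd c p)) (v c)"
      using assms unfolding tangent_space_def by blast
    then show ?thesis using True by (simp add: tvector_of_def)
  next
    case False
    then have "v c' = 0" using assms(3) unfolding tangent_space_def by blast
    then show ?thesis using False by (auto simp: tvector_of_def)
  qed
qed

lemma tvector_of_add:
  assumes "c \<in> \<A>" "p \<in> fst c"
  shows "tvector_of \<A> c p (y + y') = tv_add (tvector_of \<A> c p y) (tvector_of \<A> c p y')"
proof
  fix c' show "tvector_of \<A> c p (y + y') c' = tv_add (tvector_of \<A> c p y) (tvector_of \<A> c p y') c'"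
    using linear_add[OF linear_J[OF assms(1) _ assms(2), of c']]
    by (cases "c' \<in> \<A> \<and> p \<in> fst c'") (auto simp: tvector_of_def tv_add_def J_def)
qed

lemma tvector_of_scale:
  assumes "c \<in> \<A>" "p \<in> fst c"
  shows "tvector_of \<A> c p (r *\<^sub>R y) = tv_scale r (tvector_of \<A> c p y)"
proof
  fix c' show "tvector_of \<A> c p (r *\<^sub>R y) c' = tv_scale r (tvector_of \<A> c p y) c'"
    using linear_cmul[OF linear_J[OF assms(1) _ assms(2), of c']]
    by (cases "c' \<in> \<A> \<and> p \<in> fst c'") (auto simp: tvector_of_def tv_scale_def J_def)
qed

section \<open>Forms, metrics and connections in induced coordinates\<close>

lemma linear_form_components:
  assumes c: "c \<in> \<A>" "p \<in> fst c" and f: "linear_form_on_tangent \<A> p f"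
  shows "f (tvector_of \<A> c p y) = (\<Sum>\<mu>\<in>UNIV. f (tvector_of \<A> c p (axis \<mu> 1)) * y $ \<mu>)"
proof -
  have lin: "linear (\<lambda>y. f (tvector_of \<A> c p y))"
    using f tvector_of_in_tangent_space[OF c]
    by (intro linearI) (simp_all add: tvector_of_add[OF c] tvector_of_scale[OF c] linear_form_on_tangent_def)
  have "y = (\<Sum>\<mu>\<in>UNIV. y $ \<mu> *\<^sub>R axis \<mu> 1)"
    using basis_expansion[of y] by (simp add: scalar_mult_eq_scaleR)
  then have "f (tvector_of \<A> c p y) = f (tvector_of \<A> c p (\<Sum>\<mu>\<in>UNIV. y $ \<mu> *\<^sub>R axis \<mu> 1))"
    by simp
  then show ?thesis
    by (simp add: linear_sum[OF lin] linear_cmul[OF lin] mult.commute)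
qed

lemma form_comp_expansion:
  assumes "one_form M \<A> b" "c \<in> \<A>" "x \<in> chart_range c"
  shows "b (chart_inv c x) (tvector_of \<A> c (chart_inv c x) y) = (\<Sum>\<nu>\<in>UNIV. form_comp \<A> c b \<nu> x * y $ \<nu>)"
proof -
  have p: "chart_inv c x \<in> fst c" by (rule chart_inv_in[OF assms(3)])
  then have "chart_inv c x \<in> topspace M" using openin_subset[OF openin_chart[OF assms(2)]] by auto
  then have "linear_form_on_tangent \<A> (chart_inv c x) (b (chart_inv c x))"
    using assms(1) by (simp add: one_form_def)
  from linear_form_components[OF assms(2) p this, of y] show ?thesis
    by (simp add: form_comp_def coord_vector_def)
qed

text \<open>\<open>pseudo_riemannian_metric\<close> states linearity in the second argument; the
  expansion in the first argument comes from symmetry.\<close>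

lemma metric_comp_expansion:
  assumes a: "pseudo_riemannian_metric M \<A> a" and c: "c \<in> \<A>" and x: "x \<in> chart_range c"
  shows "a (chart_inv c x) (tvector_of \<A> c (chart_inv c x) y) (tvector_of \<A> c (chart_inv c x) y')
    = (\<Sum>\<mu>\<in>UNIV. \<Sum>\<nu>\<in>UNIV. metric_comp \<A> c a \<mu> \<nu> x * (y $ \<mu> * y' $ \<nu>))"
proof -
  let ?p = "chart_inv c x" and ?v = "\<lambda>y. tvector_of \<A> c (chart_inv c x) y"
  have p: "?p \<in> fst c" by (rule chart_inv_in[OF x])
  then have M: "?p \<in> topspace M" using openin_subset[OF openin_chart[OF c]] by auto
  have lin: "linear_form_on_tangent \<A> ?p (a ?p (?v y))" for y
    using a M tvector_of_in_tangent_space[OF c p] by (simp add: pseudo_riemannian_metric_def)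
  have sym: "a ?p (?v y) (?v y') = a ?p (?v y') (?v y)" for y y'
    using a M tvector_of_in_tangent_space[OF c p] by (simp add: pseudo_riemannian_metric_def)
  have "a ?p (?v y) (?v (axis \<nu> 1)) = (\<Sum>\<mu>\<in>UNIV. metric_comp \<A> c a \<mu> \<nu> x * y $ \<mu>)" for \<nu>
    using linear_form_components[OF c p lin, of "axis \<nu> 1" y]
    by (simp add: metric_comp_def coord_vector_def sym[of "axis \<nu> 1"])
  then have "a ?p (?v y) (?v y') = (\<Sum>\<nu>\<in>UNIV. \<Sum>\<mu>\<in>UNIV. metric_comp \<A> c a \<mu> \<nu> x * (y $ \<mu> * y' $ \<nu>))"
    using linear_form_components[OF c p lin, of y y'] by (simp add: sum_distrib_right mult.assoc)
  also have "\<dots> = (\<Sum>\<mu>\<in>UNIV. \<Sum>\<nu>\<in>UNIV. metric_comp \<A> c a \<mu> \<nu> x * (y $ \<mu> * y' $ \<nu>))"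
    by (rule sum.swap)
  finally show ?thesis .
qed

lemma smooth_metric_comp:
  assumes a: "pseudo_riemannian_metric M \<A> a" and c: "c \<in> \<A>"
  shows "smooth_metric (chart_range c) (metric_comp \<A> c a)"
proof
  show "open (chart_range c)" by (rule open_chart_range[OF c])
  show "smooth_on (chart_range c) (metric_comp \<A> c a \<mu> \<nu>)" for \<mu> \<nu>
    using a c by (simp add: pseudo_riemannian_metric_def)
next
  fix x assume x: "x \<in> chart_range c"
  let ?p = "chart_inv c x" and ?v = "\<lambda>y. tvector_of \<A> c (chart_inv c x) y"
  have p: "?p \<in> fst c" by (rule chart_inv_in[OF x])
  then have M: "?p \<in> topspace M" using openin_subset[OF openin_chart[OF c]] by auto
  have sym: "a ?p (?v y) (?v y') = a ?p (?v y') (?v y)" for y y'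
    using a M tvector_of_in_tangent_space[OF c p] by (simp add: pseudo_riemannian_metric_def)
  then show comp_sym: "metric_comp \<A> c a \<mu> \<nu> x = metric_comp \<A> c a \<nu> \<mu> x" for \<mu> \<nu>
    by (simp add: metric_comp_def coord_vector_def)
  let ?A = "(\<chi> \<mu> \<nu>. metric_comp \<A> c a \<mu> \<nu> x) :: real ^ 'n ^ 'n"
  \<comment> \<open>A kernel vector of the component matrix represents a tangent vector orthogonal
    to the whole tangent space, which nondegeneracy forces to be zero; its component in
    \<open>c\<close> is \<open>y\<close> itself.\<close>
  have "y = 0" if y: "?A *v y = 0" for y
  proof -
    have "a ?p (?v y) w = 0" if w: "w \<in> tangent_space \<A> ?p" for w
    proof -
      have "a ?p (?v y) w = a ?p (?v (w c)) (?v y)"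
        using tvector_of_tangent_vector[OF c p w] sym by metis
      also have "\<dots> = (\<Sum>\<mu>\<in>UNIV. w c $ \<mu> * (?A *v y) $ \<mu>)"
        by (simp add: metric_comp_expansion[OF a c x] matrix_vector_mult_def sum_distrib_left mult_ac)
      finally show ?thesis by (simp add: y)
    qed
    then have "?v y = tv_zero"
      using a M tvector_of_in_tangent_space[OF c p] by (simp add: pseudo_riemannian_metric_def)
    then show ?thesis using tvector_of_same[OF c p, of y] by (simp add: tv_zero_def)
  qed
  then show "invertible ?A"
    using matrix_left_invertible_ker[of ?A] by (auto simp: invertible_left_inverse)
qed

text \<open>In each fibre, \<open>\<Gamma>\<close> and \<open>\<Gamma>'\<close> give linear functions of \<open>y\<close> that agree on a nonempty open set.\<close>

lemma affine_connection_unique: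
  assumes A: "conic_subbundle M \<A> A"
    and \<Gamma>: "is_affine_connection_of \<A> A F \<Gamma>" and \<Gamma>': "is_affine_connection_of \<A> A F \<Gamma>'"
  shows "same_connection \<A> \<Gamma> \<Gamma>'"
  unfolding same_connection_def
proof (intro ballI allI)
  fix c x \<rho> \<mu> \<nu> assume c: "c \<in> \<A>" and x: "x \<in> chart_range c"
  let ?U = "local_set \<A> c A"
  have p: "chart_inv c x \<in> fst c" by (rule chart_inv_in[OF x])
  then have "chart_inv c x \<in> topspace M" using openin_subset[OF openin_chart[OF c]] by auto
  then obtain v where v: "(chart_inv c x, v) \<in> A"
    using A unfolding conic_subbundle_def by force
  then have "v \<in> tangent_space \<A> (chart_inv c x)"
    using A by (auto simp: conic_subbundle_def tangent_bundle_def)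
  then have U: "(x, v c) \<in> ?U"
    using v x by (simp add: local_set_def bundle_point_def tvector_of_tangent_vector[OF c p])
  have "open ?U" using A c by (simp add: conic_subbundle_def)
  then obtain e where e: "e > 0" "\<And>z. dist z (x, v c) < e \<Longrightarrow> z \<in> ?U"
    using U by (metis open_dist)
  \<comment> \<open>The shift is short enough to stay inside \<open>local_set\<close>. Subtracting
    the identities at \<open>v c\<close> and at \<open>y\<close> isolates the coefficient with index
    \<open>\<nu>\<close>.\<close>
  define y where "y = v c + (e / 2) *\<^sub>R axis \<nu> 1"
  have "dist (x, y) (x, v c) < e"
    using e(1) by (simp add: y_def dist_prod_def dist_norm)
  then have U': "(x, y) \<in> ?U" by (rule e(2))
  have eq: "(\<Sum>\<nu>\<in>UNIV. \<Gamma> c \<rho> \<mu> \<nu> (fst z) * snd z $ \<nu>) = (\<Sum>\<nu>\<in>UNIV. \<Gamma>' c \<rho> \<mu> \<nu> (fst z) * snd z $ \<nu>)"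
    if "z \<in> ?U" for z
    using \<Gamma> \<Gamma>' c that by (simp add: is_affine_connection_of_def)
  have "(\<Sum>\<kappa>\<in>UNIV. G c \<rho> \<mu> \<kappa> x * y $ \<kappa>)
      = (\<Sum>\<kappa>\<in>UNIV. G c \<rho> \<mu> \<kappa> x * v c $ \<kappa>) + (e / 2) * G c \<rho> \<mu> \<nu> x"
    for G :: "('m, 'n) connection_coeffs"
  proof -
    have "(\<Sum>\<kappa>\<in>UNIV. G c \<rho> \<mu> \<kappa> x * y $ \<kappa>)
      = (\<Sum>\<kappa>\<in>UNIV. G c \<rho> \<mu> \<kappa> x * v c $ \<kappa>) + (\<Sum>\<kappa>\<in>UNIV. (e / 2 * G c \<rho> \<mu> \<kappa> x) * axis \<nu> 1 $ \<kappa>)"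
      by (simp add: y_def distrib_left sum.distrib mult_ac)
    then show ?thesis by (simp only: sum_axis_mult)
  qed
  then show "\<Gamma> c \<rho> \<mu> \<nu> x = \<Gamma>' c \<rho> \<mu> \<nu> x"
    using eq[OF U] eq[OF U'] e(1) by simp
qed

text \<open>In each chart \<open>L\<close> is a function of the coordinate expressions
  \<open>?A\<close> of \<open>a(y, y)\<close> and \<open>?B\<close> of \<beta>. Both have zero
  derivative along the horizontal lifts, hence so has \<open>L\<close>.\<close>

lemma alpha_beta_lagrangian:
  assumes F: "alpha_beta_metric M \<A> A F a b" and b: "covariantly_constant \<A> a b" and c: "c \<in> \<A>"
  shows "horizontally_constant_lagrangian (chart_range c) (christoffel (metric_comp \<A> c a))
    (local_set \<A> c A) (local_lagrangian \<A> c F)"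
proof -
  have a: "pseudo_riemannian_metric M \<A> a" and one: "one_form M \<A> b" and fin: "finsler_metric M \<A> A F"
    using F by (auto simp: alpha_beta_metric_def)
  obtain D \<phi> where D: "smooth_on D \<phi>"
    "\<And>p v. (p, v) \<in> A \<Longrightarrow> sqrt \<bar>a p v v\<bar> \<noteq> 0 \<and> b p v / sqrt \<bar>a p v v\<bar> \<in> D \<and>
      F (p, v) = sqrt \<bar>a p v v\<bar> * \<phi> (b p v / sqrt \<bar>a p v v\<bar>)"
    using F unfolding alpha_beta_metric_def Let_def by fast
  interpret smooth_metric "chart_range c" "metric_comp \<A> c a"
    by (rule smooth_metric_comp[OF a c])
  let ?U = "local_set \<A> c A" and ?L = "local_lagrangian \<A> c F"
  let ?A = "\<lambda>z. \<Sum>\<mu>\<in>UNIV. \<Sum>\<nu>\<in>UNIV. metric_comp \<A> c a \<mu> \<nu> (fst z) * (snd z $ \<mu> * snd z $ \<nu>)"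
  let ?B = "\<lambda>z. \<Sum>\<nu>\<in>UNIV. form_comp \<A> c b \<nu> (fst z) * snd z $ \<nu>"
  have U: "open ?U" using fin c by (simp add: finsler_metric_def conic_subbundle_def)
  have x: "fst z \<in> chart_range c" if "z \<in> ?U" for z using that by (simp add: local_set_def)
  have local: "?A z \<noteq> 0 \<and> ?B z / sqrt \<bar>?A z\<bar> \<in> D \<and> ?L z = (sqrt \<bar>?A z\<bar> * \<phi> (?B z / sqrt \<bar>?A z\<bar>))\<^sup>2"
    if "z \<in> ?U" for z
  proof -
    have "bundle_point \<A> c z \<in> A" using that by (simp add: local_set_def)
    then show ?thesis
      using D(2)[of "chart_inv c (fst z)" "tvector_of \<A> c (chart_inv c (fst z)) (snd z)"]
      by (simp add: local_lagrangian_def local_fun_def bundle_point_def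
          metric_comp_expansion[OF a c x[OF that]] form_comp_expansion[OF one c x[OF that]])
  qed
  show ?thesis
  proof
    show "open ?U" by (rule U)
    show "fst z \<in> chart_range c" if "z \<in> ?U" for z by (rule x[OF that])
    show "smooth_on ?U ?L"
      unfolding local_lagrangian_def power2_eq_square
      using fin c by (intro smooth_on_mult U) (auto simp: finsler_metric_def)
    show "invertible (\<chi> \<mu> \<nu>. fund_tensor ?L \<mu> \<nu> z)" if "z \<in> ?U" for z
      using fin c that by (simp add: finsler_metric_def)
    show "dx \<mu> ?L z = (\<Sum>\<rho>\<in>UNIV. N \<rho> \<mu> z * dy \<rho> ?L z)" if z: "z \<in> ?U" for z \<mu>
    proof -
      obtain A' where A': "(?A has_derivative A') (at z)" "\<And>\<kappa>. A' (hvec \<kappa> z) = 0"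
        using quadratic_form_horizontal[OF x[OF z]] by blast
      have bdiff: "form_comp \<A> c b \<nu> differentiable (at (fst z))" for \<nu>
        using one c x[OF z] by (intro smooth_on_differentiable[of "chart_range c"]) (auto simp: one_form_def)
      have par: "pd \<mu> (form_comp \<A> c b \<nu>) (fst z)
          = (\<Sum>\<rho>\<in>UNIV. christoffel (metric_comp \<A> c a) \<rho> \<mu> \<nu> (fst z) * form_comp \<A> c b \<rho> (fst z))" for \<mu> \<nu>
        using b c x[OF z] by (simp add: covariantly_constant_def)
      obtain B' where B': "(?B has_derivative B') (at z)" "\<And>\<kappa>. B' (hvec \<kappa> z) = 0"
        using linear_form_horizontal[OF x[OF z] bdiff par] by blast
      have "\<phi> differentiable (at (?B z / sqrt \<bar>?A z\<bar>))"
        using local[OF z] by (intro smooth_on_differentiable[OF D(1)]) simp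
      then obtain D' where D': "((\<lambda>z. (sqrt \<bar>?A z\<bar> * \<phi> (?B z / sqrt \<bar>?A z\<bar>))\<^sup>2) has_derivative D') (at z)"
        "\<And>k. A' k = 0 \<Longrightarrow> B' k = 0 \<Longrightarrow> D' k = 0"
        using alpha_beta_derivative_vanishes[OF A'(1) B'(1)] local[OF z] by blast
      \<comment> \<open>The formula in \<open>?A\<close> and \<open>?B\<close> holds on all of
        \<open>?U\<close>, and openness of \<open>?U\<close> transfers the derivative to
        \<open>?L\<close>.\<close>
      have "(?L has_derivative D') (at z)"
        using local by (intro has_derivative_transform_within_open[OF D'(1) U z]) simp
      then show ?thesis
        by (rule hvec_derivative) (rule D'(2)[OF A'(2) B'(2)])
    qed
  qed
qed

end

section \<open>From the chart-wise results to the manifold\<close>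

theorem theorem8p1p1:
  fixes M :: "'m topology"
    and \<A> :: "('m, 4) chart set"
    and A :: "('m, 4) tpoint set"
    and F :: "('m, 4) tpoint \<Rightarrow> real"
    and a :: "('m, 4) bilinear_field"
    and b :: "('m, 4) covector_field"
  assumes "smooth_manifold M \<A>"
    and "alpha_beta_metric M \<A> A F a b"
    and "solves_einstein_vacuum \<A> a"
    and "covariantly_constant \<A> a b"
  shows "ricci_flat \<A> A F \<and> finsler_vacuum_solution \<A> A F \<and> berwald_type \<A> A F \<and>
    (\<forall>\<Gamma>. is_affine_connection_of \<A> A F \<Gamma> \<longleftrightarrow> same_connection \<A> \<Gamma> (levi_civita \<A> a))"
proof -
  interpret manifold M \<A> by standard (rule assms(1))
  have flat: "ricci_flat_lagrangian (chart_range c) (christoffel (metric_comp \<A> c a))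
      (local_set \<A> c A) (local_lagrangian \<A> c F)" if c: "c \<in> \<A>" for c
  proof -
    interpret horizontally_constant_lagrangian "chart_range c" "christoffel (metric_comp \<A> c a)"
      "local_set \<A> c A" "local_lagrangian \<A> c F"
      by (rule alpha_beta_lagrangian[OF assms(2,4) c])
    show ?thesis
      \<comment> \<open>The one remaining goal is \<open>ricci_zero\<close>, which is the vacuum
        Einstein equation with \<open>ricci_comp\<close> unfolded.\<close>
      by standard (use assms(3) c in \<open>simp add: solves_einstein_vacuum_def ricci_comp_def\<close>)
  qed
  have ricci: "ricci_flat \<A> A F"
    using ricci_flat_lagrangian.finsler_ricci_zero[OF flat] by (simp add: ricci_flat_def)
  have vacuum: "finsler_vacuum_solution \<A> A F"
    using field_equation_of_ricci_flat_lagrangian[OF flat] by (simp add: finsler_vacuum_solution_def)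
  have affine: "is_affine_connection_of \<A> A F (levi_civita \<A> a)"
    unfolding is_affine_connection_of_def levi_civita_def
  proof (intro ballI allI)
    fix c z \<rho> \<mu> assume c: "c \<in> \<A>" and z: "z \<in> local_set \<A> c A"
    interpret ricci_flat_lagrangian "chart_range c" "christoffel (metric_comp \<A> c a)"
      "local_set \<A> c A" "local_lagrangian \<A> c F"
      by (rule flat[OF c])
    show "nonlinear_conn (local_lagrangian \<A> c F) \<rho> \<mu> z
        = (\<Sum>\<nu>\<in>UNIV. christoffel (metric_comp \<A> c a) \<rho> \<mu> \<nu> (fst z) * snd z $ \<nu>)"
      using nonlinear_conn_eq[OF z] by (simp add: N_def)
  qed
  have conic: "conic_subbundle M \<A> A"
    using assms(2) by (simp add: alpha_beta_metric_def finsler_metric_def)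
  have "is_affine_connection_of \<A> A F \<Gamma> \<longleftrightarrow> same_connection \<A> \<Gamma> (levi_civita \<A> a)" for \<Gamma>
  proof
    assume "is_affine_connection_of \<A> A F \<Gamma>"
    then show "same_connection \<A> \<Gamma> (levi_civita \<A> a)"
      by (rule affine_connection_unique[OF conic _ affine])
  next
    assume "same_connection \<A> \<Gamma> (levi_civita \<A> a)"
    then show "is_affine_connection_of \<A> A F \<Gamma>"
      \<comment> \<open>Points of \<open>local_set\<close> lie over the chart range, exactly where
        \<open>same_connection\<close> compares the coefficients.\<close>
      using affine by (auto simp: is_affine_connection_of_def same_connection_def local_set_def)
  qed
  then show ?thesis using ricci vacuum affine by (auto simp: berwald_type_def)
qed

end
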